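(* For the $N+1$ player game, the system of ODEs $$-\dot u(i,n,t)=f(i,n)-\tfrac12\alpha^*(i,n,t)^2+\eta(u(1-i,n,t)-u(i,n,t))+\gamma^+(i,n,t)(u(i,n+1,t)-u(i,n,t))+\gamma^-(i,n,t)(u(i,n-1,t)-u(i,n,t)),$$ $$u(i,n,T)=\psi(i,n),\qquad i\in\{0,1\},\ n\in\{0,\dots,N\},\ t\in[0,T],$$ where $\alpha^*(i,n,t)=(u(i,n,t)-u(1-i,n,t))_+$, $\gamma^+(i,n,t)=(N-n)(\alpha^*(1,n+1-i,t)+\eta)$, $\gamma^-(i,n,t)=n(\alpha^*(0,n-i,t)+\eta)$, has a unique solution. The strategy profile in which all $N+1$ players use $\alpha^*$ is a Markov perfect Nash equilibrium, and it is the unique Nash equilibrium among all Markov (state feedback) strategy profiles, including those in which controls may depend on the full state in $\{0,1\}^{N+1}$.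
   Context: Fix $T>0$, $\eta\ge0$, $N\ge1$, and functions $f,\psi:\{0,1\}\times[0,1]\to\mathbb R$ that are bounded and uniformly Lipschitz continuous in the second argument; write $f(i,n)=f(i,n/N)$, $\psi(i,n)=\psi(i,n/N)$ and $a_+=\max(a,0)$. The $N+1$ player game. Each player has state in $\{0,1\}$. A Markov (state feedback) strategy for a player is a nonnegative control that is a function of time and of the current states of all players in $\{0,1\}^{N+1}$; a special case is a function $\alpha(i,n,t)$ of the player's own state $i$, the number $n$ of other players in state 0, and $t$. A player whose control currently has value $\alpha$ jumps from state $i$ to $1-i$ at rate $\alpha+\eta$; conditionally on the current states, players jump independently. Each player's cost from time $t$ on is $E\big[\int_t^T (f(i(s),\theta_s)+\tfrac12\alpha_s^2)\,ds+\psi(i(T),\theta_T)\big]$, where $\theta_s$ is the fraction of the other $N$ players in state 0 at time $s$. Best responses are understood in the Hamilton-Jacobi-Bellman sense: for fixed strategies of the other players, a player's best response is the control $(v(s,t)-v(s',t))_+$ in state $s\in\{0,1\}^{N+1}$, where $v$ is the player's optimal cost-to-go function (solving the HJB terminal value problem on $[0,T]$) and $s'$ is $s$ with that player's own state flipped; this minimizes the cost from every time $t$ and every state. A Nash equilibrium among Markov strategy profiles is a profile in which each player's strategy is the best response to those of the others. It is Markov perfect if it yields a best response on every interval $[t,T]$. *)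

theory Defs
  imports "HOL-Analysis.Analysis"
begin

text \<open>
  The players are \<open>0, \<dots>, N\<close>. A full state assigns to each player an element of \<open>{0, 1}\<close>.
  A strategy maps the full state and the time to the value of the control; a profile
  assigns a strategy to each player. The data \<open>f\<close>, \<open>psi\<close> take the own state in \<open>{0, 1}\<close>
  and the fraction in \<open>[0, 1]\<close> of the other players that are in state 0.
\<close>

type_synonym state = "nat \<Rightarrow> nat"
type_synonym strategy = "state \<Rightarrow> real \<Rightarrow> real"
type_synonym profile = "nat \<Rightarrow> strategy"

definition states :: "nat \<Rightarrow> state set" where
  "states N = PiE {..N} (\<lambda>_. {0, 1})"

definition flip :: "nat \<Rightarrow> state \<Rightarrow> state" where
  "flip k s = s(k := 1 - s k)"

definition others0 :: "nat \<Rightarrow> nat \<Rightarrow> state \<Rightarrow> nat" where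
  "others0 N k s = card {j \<in> {..N} - {k}. s j = 0}"

definition admissible_data :: "(nat \<Rightarrow> real \<Rightarrow> real) \<Rightarrow> bool" where
  "admissible_data g \<longleftrightarrow>
     bounded {g i x | i x. i \<in> {0, 1} \<and> x \<in> {0..1}} \<and>
     (\<exists>L. \<forall>i\<in>{0, 1}. L-lipschitz_on {0..1} (g i))"

definition markov_strategy :: "nat \<Rightarrow> real \<Rightarrow> real \<Rightarrow> strategy \<Rightarrow> bool" where
  "markov_strategy N t0 T a \<longleftrightarrow>
     (\<forall>s\<in>states N. (\<forall>t\<in>{t0..T}. 0 \<le> a s t) \<and> a s \<in> borel_measurable (lebesgue_on {t0..T}))"

text \<open>
  \<open>p s t\<close> is the probability of being in state \<open>s\<close> at time \<open>t\<close>, for the jump process that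
  starts in \<open>s0\<close> at time \<open>t0\<close> and in which player \<open>j\<close> flips its own state at rate
  \<open>\<alpha> j s t + eta\<close>. Conditional independence of the players means that the only transitions
  are the flips of single players, so the forward (master) equation is as below. It is
  written in integrated form because the rates are only measurable in time; that the total
  mass is 1 follows by summation over the states.
\<close>

definition state_law ::
  "nat \<Rightarrow> real \<Rightarrow> profile \<Rightarrow> real \<Rightarrow> real \<Rightarrow> state \<Rightarrow> (state \<Rightarrow> real \<Rightarrow> real) \<Rightarrow> bool" where
  "state_law N eta \<alpha> t0 T s0 p \<longleftrightarrow>
     (\<forall>s\<in>states N. \<forall>t\<in>{t0..T}. 0 \<le> p s t \<and>
        ((\<lambda>r. \<Sum>j\<le>N. (\<alpha> j (flip j s) r + eta) * p (flip j s) r - (\<alpha> j s r + eta) * p s r)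
           has_integral (p s t - of_bool (s = s0))) {t0..t})"

text \<open>
  \<open>c\<close> is player \<open>k\<close>'s expected cost from time \<open>t0\<close> and state \<open>s0\<close> on under the profile \<open>\<alpha>\<close>.
  Expectations of functions of the state at a single time are sums over \<open>states N\<close> weighted
  by the law, and the expectation is exchanged with the time integral of the running cost.
\<close>

definition expected_cost ::
  "nat \<Rightarrow> real \<Rightarrow> (nat \<Rightarrow> real \<Rightarrow> real) \<Rightarrow> (nat \<Rightarrow> real \<Rightarrow> real) \<Rightarrow> real \<Rightarrow> nat
    \<Rightarrow> profile \<Rightarrow> state \<Rightarrow> real \<Rightarrow> real \<Rightarrow> bool" where
  "expected_cost N eta f psi T k \<alpha> s0 t0 c \<longleftrightarrow>
     (\<exists>p. state_law N eta \<alpha> t0 T s0 p \<and>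
        ((\<lambda>r. \<Sum>s\<in>states N. p s r * (f (s k) (real (others0 N k s) / real N) + (\<alpha> k s r)\<^sup>2 / 2))
           has_integral (c - (\<Sum>s\<in>states N. p s T * psi (s k) (real (others0 N k s) / real N)))) {t0..T})"

text \<open>
  The infimum is taken in \<open>ereal\<close>, so that it is finite only if some strategy has finite
  cost and the costs are bounded below. Strategies with infinite cost do not contribute.
\<close>

definition optimal_cost ::
  "nat \<Rightarrow> real \<Rightarrow> (nat \<Rightarrow> real \<Rightarrow> real) \<Rightarrow> (nat \<Rightarrow> real \<Rightarrow> real) \<Rightarrow> real \<Rightarrow> nat
    \<Rightarrow> profile \<Rightarrow> state \<Rightarrow> real \<Rightarrow> ereal" where
  "optimal_cost N eta f psi T k \<alpha> s t =
     (INF c \<in> {c. \<exists>a. markov_strategy N t T a \<and>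
                      expected_cost N eta f psi T k (\<alpha>(k := a)) s t c}. ereal c)"

text \<open>
  The HJB terminal value problem of player \<open>k\<close> on \<open>[t0, T]\<close> against the strategies
  \<open>\<alpha> j\<close>, \<open>j \<noteq> k\<close>, integrated from \<open>t\<close> to \<open>T\<close> because these are only measurable in time.
\<close>

definition hjb_solution ::
  "nat \<Rightarrow> real \<Rightarrow> (nat \<Rightarrow> real \<Rightarrow> real) \<Rightarrow> (nat \<Rightarrow> real \<Rightarrow> real) \<Rightarrow> real \<Rightarrow> real \<Rightarrow> nat
    \<Rightarrow> profile \<Rightarrow> (state \<Rightarrow> real \<Rightarrow> real) \<Rightarrow> bool" where
  "hjb_solution N eta f psi t0 T k \<alpha> v \<longleftrightarrow>
     (\<forall>s\<in>states N. \<forall>t\<in>{t0..T}.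
        ((\<lambda>r. f (s k) (real (others0 N k s) / real N)
              + (INF a\<in>{0..}. a\<^sup>2 / 2 + (a + eta) * (v (flip k s) r - v s r))
              + (\<Sum>j\<in>{..N} - {k}. (\<alpha> j s r + eta) * (v (flip j s) r - v s r)))
           has_integral (v s t - psi (s k) (real (others0 N k s) / real N))) {t..T})"

text \<open>Player \<open>k\<close>'s strategy is the best response on \<open>[t0, T]\<close> to those of the others.\<close>

definition best_response ::
  "nat \<Rightarrow> real \<Rightarrow> (nat \<Rightarrow> real \<Rightarrow> real) \<Rightarrow> (nat \<Rightarrow> real \<Rightarrow> real) \<Rightarrow> real \<Rightarrow> real \<Rightarrow> nat
    \<Rightarrow> profile \<Rightarrow> bool" where
  "best_response N eta f psi t0 T k \<alpha> \<longleftrightarrow>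
     (\<exists>v. (\<forall>s\<in>states N. \<forall>t\<in>{t0..T}. ereal (v s t) = optimal_cost N eta f psi T k \<alpha> s t) \<and>
          hjb_solution N eta f psi t0 T k \<alpha> v \<and>
          (\<forall>s\<in>states N. \<forall>t\<in>{t0..T}. \<alpha> k s t = max (v s t - v (flip k s) t) 0))"

definition nash_equilibrium ::
  "nat \<Rightarrow> real \<Rightarrow> (nat \<Rightarrow> real \<Rightarrow> real) \<Rightarrow> (nat \<Rightarrow> real \<Rightarrow> real) \<Rightarrow> real \<Rightarrow> profile \<Rightarrow> bool" where
  "nash_equilibrium N eta f psi T \<alpha> \<longleftrightarrow>
     (\<forall>k\<le>N. markov_strategy N 0 T (\<alpha> k) \<and> best_response N eta f psi 0 T k \<alpha>)"

definition markov_perfect ::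
  "nat \<Rightarrow> real \<Rightarrow> (nat \<Rightarrow> real \<Rightarrow> real) \<Rightarrow> (nat \<Rightarrow> real \<Rightarrow> real) \<Rightarrow> real \<Rightarrow> profile \<Rightarrow> bool" where
  "markov_perfect N eta f psi T \<alpha> \<longleftrightarrow>
     (\<forall>t0\<in>{0..T}. \<forall>k\<le>N. best_response N eta f psi t0 T k \<alpha>)"

definition alpha_star :: "(nat \<Rightarrow> nat \<Rightarrow> real \<Rightarrow> real) \<Rightarrow> nat \<Rightarrow> nat \<Rightarrow> real \<Rightarrow> real" where
  "alpha_star u i n t = max (u i n t - u (1 - i) n t) 0"

text \<open>
  For \<open>i \<in> {0, 1}\<close> and \<open>n \<le> N\<close>, indices outside the range (a count \<open>N + 1\<close>, or a truncated
  \<open>0 - 1\<close>) occur below only in terms whose factor \<open>N - n\<close> or \<open>n\<close> vanishes.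
\<close>

definition gamma_plus ::
  "nat \<Rightarrow> real \<Rightarrow> (nat \<Rightarrow> nat \<Rightarrow> real \<Rightarrow> real) \<Rightarrow> nat \<Rightarrow> nat \<Rightarrow> real \<Rightarrow> real" where
  "gamma_plus N eta u i n t = (real N - real n) * (alpha_star u 1 (n + 1 - i) t + eta)"

definition gamma_minus ::
  "real \<Rightarrow> (nat \<Rightarrow> nat \<Rightarrow> real \<Rightarrow> real) \<Rightarrow> nat \<Rightarrow> nat \<Rightarrow> real \<Rightarrow> real" where
  "gamma_minus eta u i n t = real n * (alpha_star u 0 (n - i) t + eta)"

definition ode_solution ::
  "nat \<Rightarrow> real \<Rightarrow> (nat \<Rightarrow> real \<Rightarrow> real) \<Rightarrow> (nat \<Rightarrow> real \<Rightarrow> real) \<Rightarrow> real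
    \<Rightarrow> (nat \<Rightarrow> nat \<Rightarrow> real \<Rightarrow> real) \<Rightarrow> bool" where
  "ode_solution N eta f psi T u \<longleftrightarrow>
     (\<forall>i\<in>{0, 1}. \<forall>n\<le>N.
        u i n T = psi i (real n / real N) \<and>
        (\<forall>t\<in>{0..T}.
           (u i n has_real_derivative
              - (f i (real n / real N) - (alpha_star u i n t)\<^sup>2 / 2
                 + eta * (u (1 - i) n t - u i n t)
                 + gamma_plus N eta u i n t * (u i (n + 1) t - u i n t)
                 + gamma_minus eta u i n t * (u i (n - 1) t - u i n t)))
           (at t within {0..T})))"

definition symmetric_profile :: "nat \<Rightarrow> (nat \<Rightarrow> nat \<Rightarrow> real \<Rightarrow> real) \<Rightarrow> profile" where
  "symmetric_profile N a = (\<lambda>k s t. a (s k) (others0 N k s) t)"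

end

theory Submission
  imports Defs
begin

text \<open>
  An a priori bound by the maximum principle makes the quadratic system globally solvable.
  The value \<open>u (s k) (others0 N k s)\<close> then solves player \<open>k\<close>'s HJB equation against the
  symmetric profile, because the other players in state 0 and in state 1 number \<open>n\<close> and
  \<open>N - n\<close> and each sees a count that depends only on the own state and on \<open>(i, n)\<close>. The cost
  of any deviation minus this value is the time integral of an expected nonnegative excess
  Hamiltonian, which gives optimality. Conversely, the value functions of all players in any
  Nash equilibrium solve one coupled HJB system on the full state space; its right-hand
  side is locally Lipschitz, so it has the symmetric solution only.
\<close>

section \<open>Ordinary differential equations with finitely many unknowns\<close>

text \<open>Two sources of bounds have to be kept apart. Existence needs an a priori bound, since a
  quadratic system could blow up; uniqueness does not, because two given solutions are continuous on
  a compact interval and therefore lie in a common box, where the right-hand side is Lipschitz.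
  Regularity in time is the other obstacle. A deviation is only measurable and may be unbounded, so
  that the law of the state is absolutely continuous but need not be differentiable; the expected
  value along the law is therefore treated by an integrated product rule. In an equilibrium, by
  contrast, every control is given by the response formula and inherits the regularity of a value
  function, so that the integrated HJB problem becomes a classical one. No symmetry is assumed of a
  competing equilibrium. The coupled system has one unknown for each player and each full state, the
  values built from \<open>u\<close> are one solution of it, and uniqueness then forces every
  equilibrium control to depend only on the own state and the count.\<close>

lemma gronwall_zero_backward:
  fixes z z' :: "'a \<Rightarrow> real \<Rightarrow> real"
  assumes fin: "finite I"
    and der: "\<And>i t. i \<in> I \<Longrightarrow> t \<in> {a..b} \<Longrightarrow> (z i has_real_derivative z' i t) (at t within {a..b})"
    and bound: "\<And>i t. i \<in> I \<Longrightarrow> t \<in> {a..b} \<Longrightarrow> \<bar>z' i t\<bar> \<le> L * (\<Sum>j\<in>I. \<bar>z j t\<bar>)"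
    and terminal: "\<And>i. i \<in> I \<Longrightarrow> z i b = 0"
    and i: "i \<in> I" and t: "t \<in> {a..b}"
  shows "z i t = 0"
proof -
  define K where "K = 2 * \<bar>L\<bar> * card I"
  \<comment> \<open>Squares keep the functional differentiable, which absolute values would not.
    Cauchy-Schwarz turns the squared sum of absolute values back into \<open>E\<close> and
    contributes the factor \<open>card I\<close> to \<open>K\<close>.\<close>
  define E where "E = (\<lambda>t. \<Sum>i\<in>I. (z i t)\<^sup>2)"
  define E' where "E' = (\<lambda>t. \<Sum>i\<in>I. 2 * z i t * z' i t)"
  have E_der: "(E has_real_derivative E' t) (at t within {a..b})" if "t \<in> {a..b}" for t
    unfolding E_def E'_def
    by (rule DERIV_sum) (auto intro!: derivative_eq_intros der that)
  have E'_bound: "\<bar>E' t\<bar> \<le> K * E t" if "t \<in> {a..b}" for t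
  proof -
    have "\<bar>E' t\<bar> \<le> (\<Sum>i\<in>I. 2 * \<bar>z i t\<bar> * (\<bar>L\<bar> * (\<Sum>j\<in>I. \<bar>z j t\<bar>)))"
      unfolding E'_def
    proof (rule order_trans[OF sum_abs sum_mono])
      fix i assume "i \<in> I"
      have "L * (\<Sum>j\<in>I. \<bar>z j t\<bar>) \<le> \<bar>L\<bar> * (\<Sum>j\<in>I. \<bar>z j t\<bar>)"
        by (intro mult_right_mono sum_nonneg) auto
      then have "\<bar>z' i t\<bar> \<le> \<bar>L\<bar> * (\<Sum>j\<in>I. \<bar>z j t\<bar>)"
        using bound[OF \<open>i \<in> I\<close> that] by linarith
      then show "\<bar>2 * z i t * z' i t\<bar> \<le> 2 * \<bar>z i t\<bar> * (\<bar>L\<bar> * (\<Sum>j\<in>I. \<bar>z j t\<bar>))"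
        by (auto simp: abs_mult intro!: mult_left_mono)
    qed
    also have "\<dots> = 2 * \<bar>L\<bar> * (\<Sum>j\<in>I. \<bar>z j t\<bar>)\<^sup>2"
      by (simp add: power2_eq_square sum_distrib_left sum_distrib_right mult_ac)
    also have "\<dots> \<le> 2 * \<bar>L\<bar> * (E t * card I)"
      using sum_squared_le_sum_of_squares[of "\<lambda>j. \<bar>z j t\<bar>" I]
      by (intro mult_left_mono) (auto simp: E_def)
    finally show ?thesis by (simp add: K_def mult_ac)
  qed
  \<comment> \<open>\<open>E' \<ge> - K * E\<close> makes this product nondecreasing, so that its
    zero at \<open>b\<close> propagates backward in time.\<close>
  define G where "G = (\<lambda>t. E t * exp (K * t))"
  have G_der: "(G has_real_derivative (E' t + K * E t) * exp (K * t)) (at t within {a..b})"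
    if "t \<in> {a..b}" for t
    unfolding G_def by (auto intro!: derivative_eq_intros E_der that simp: algebra_simps)
  have "G t \<le> G b"
  proof (rule DERIV_nonneg_imp_increasing_open[where f = G])
    show "continuous_on {t..b} G"
      by (rule continuous_on_subset[OF DERIV_continuous_on[OF G_der]]) (use t in auto)
    fix x assume "t < x" "x < b"
    then have x: "x \<in> {a..b}" "x \<in> interior {a..b}" using t by auto
    have "(G has_real_derivative (E' x + K * E x) * exp (K * x)) (at x)"
      using G_der[OF x(1)] at_within_interior[OF x(2)] by simp
    then show "\<exists>y. (G has_real_derivative y) (at x) \<and> 0 \<le> y"
      using E'_bound[OF x(1)] by (force intro!: exI mult_nonneg_nonneg)
  qed (use t in auto)
  also have "G b = 0" unfolding G_def E_def by (simp add: terminal)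
  finally have "E t \<le> 0" unfolding G_def by (simp add: mult_le_0_iff)
  moreover have "(z i t)\<^sup>2 \<le> E t"
    unfolding E_def by (rule member_le_sum) (auto simp: fin i)
  ultimately have "(z i t)\<^sup>2 \<le> 0" by linarith
  then show ?thesis by simp
qed

text \<open>After the last time with \<open>g \<le> 0\<close>, which exists by closedness,
  \<open>g\<close> is positive and hence nonincreasing, so it cannot have left the nonpositive
  half-line. Requiring the sign of \<open>g'\<close> only where \<open>g\<close> is positive suits
  clipped fields: past the barrier the clipped value is known explicitly.\<close>

lemma barrier_nonpos:
  fixes g g' :: "real \<Rightarrow> real"
  assumes der: "\<And>t. t \<in> {a..b} \<Longrightarrow> (g has_real_derivative g' t) (at t within {a..b})"
    and init: "g a \<le> 0"
    and decr: "\<And>t. t \<in> {a..b} \<Longrightarrow> g t > 0 \<Longrightarrow> g' t \<le> 0"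
    and t: "t \<in> {a..b}"
  shows "g t \<le> 0"
proof -
  have cont: "continuous_on {a..b} g"
    using der by (rule DERIV_continuous_on)
  define S where "S = {a..t} \<inter> g -` {..0}"
  have contt: "continuous_on {a..t} g"
    by (rule continuous_on_subset[OF cont]) (use t in auto)
  have "closed S" unfolding S_def
    by (rule continuous_closed_preimage[OF contt]) auto
  moreover have "a \<in> S" using init t by (auto simp: S_def)
  moreover have "bdd_above S" by (rule bdd_above_mono[of "{a..t}"]) (auto simp: S_def)
  ultimately have sup: "Sup S \<in> S" by (intro closed_contains_Sup) auto
  have pos: "g x > 0" if "Sup S < x" "x \<le> t" for x
  proof (rule ccontr)
    assume "\<not> g x > 0"
    then have "x \<in> S" using that sup by (auto simp: S_def)
    then have "x \<le> Sup S" using \<open>bdd_above S\<close> by (rule cSup_upper)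
    then show False using that by simp
  qed
  have "g t \<le> g (Sup S)"
  proof (rule DERIV_nonpos_imp_decreasing_open[where f = g])
    show "Sup S \<le> t" using sup by (auto simp: S_def)
    show "continuous_on {Sup S..t} g"
      by (rule continuous_on_subset[OF contt]) (use sup in \<open>auto simp: S_def\<close>)
    fix x assume "Sup S < x" "x < t"
    then have x: "x \<in> {a..b}" "x \<in> interior {a..b}" using t sup by (auto simp: S_def)
    have "(g has_real_derivative g' x) (at x)"
      using der[OF x(1)] at_within_interior[OF x(2)] by simp
    then show "\<exists>y. (g has_real_derivative y) (at x) \<and> y \<le> 0"
      using decr[OF x(1)] pos \<open>Sup S < x\<close> \<open>x < t\<close> by force
  qed
  with sup show ?thesis by (auto simp: S_def)
qed

lemma uniform_limit_sum:
  fixes f :: "'i \<Rightarrow> 'n \<Rightarrow> 'a \<Rightarrow> 'b::real_normed_vector"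
  assumes "\<And>i. i \<in> I \<Longrightarrow> uniform_limit S (f i) (g i) F"
  shows "uniform_limit S (\<lambda>n x. \<Sum>i\<in>I. f i n x) (\<lambda>x. \<Sum>i\<in>I. g i x) F"
  using assms
  by (induction I rule: infinite_finite_induct) (auto intro: uniform_limit_intros)

text \<open>The lower endpoint of the primitive enters with a negative sign and is dropped. The gain
  \<open>1 / K\<close> is what lets a fast growing weight produce a contraction.\<close>

lemma exp_integral_le:
  fixes a t K c :: real
  assumes "a \<le> t" "K > 0" "c \<ge> 0"
  shows "integral {a..t} (\<lambda>r. c * exp (K * (r - a))) \<le> c * exp (K * (t - a)) / K"
proof -
  have "((\<lambda>r. c * exp (K * (r - a))) has_integral
      (c * exp (K * (t - a)) / K - c * exp (K * (a - a)) / K)) {a..t}"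
    by (rule fundamental_theorem_of_calculus)
      (use assms in \<open>auto intro!: derivative_eq_intros
         simp: has_real_derivative_iff_has_vector_derivative[symmetric]\<close>)
  from integral_unique[OF this] show ?thesis using assms by (simp del: integral_mult_right)
qed

text \<open>
  Successive Picard iterates contract by the factor 1/2 once differences at time \<open>t\<close> are
  weighted with \<open>exp (2 * K * (t - a))\<close>; this makes the solution global on \<open>{a..b}\<close>.
\<close>

theorem picard_lindelof_finite:
  fixes F :: "'a \<Rightarrow> ('a \<Rightarrow> real) \<Rightarrow> real \<Rightarrow> real"
  assumes fin: "finite I" and ab: "a \<le> b"
    and lip: "\<And>i x y t. i \<in> I \<Longrightarrow> t \<in> {a..b} \<Longrightarrow>
      \<bar>F i x t - F i y t\<bar> \<le> L * (\<Sum>j\<in>I. \<bar>x j - y j\<bar>)"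
    and cont: "\<And>i x. i \<in> I \<Longrightarrow> (\<And>j. j \<in> I \<Longrightarrow> continuous_on {a..b} (x j)) \<Longrightarrow>
      continuous_on {a..b} (\<lambda>t. F i (\<lambda>j. x j t) t)"
  obtains x where "\<And>i. i \<in> I \<Longrightarrow> x i a = x0 i"
    and "\<And>i t. i \<in> I \<Longrightarrow> t \<in> {a..b} \<Longrightarrow>
      (x i has_real_derivative F i (\<lambda>j. x j t) t) (at t within {a..b})"
proof -
  define P where "P = (\<lambda>x i t. x0 i + integral {a..t} (\<lambda>r. F i (\<lambda>j. x j r) r))"
  define X where "X = (\<lambda>n. (P ^^ n) (\<lambda>i t. x0 i))"
  have X0: "X 0 i t = x0 i" and XS: "X (Suc n) = P (X n)" for n i t
    by (simp_all add: X_def)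
  have P_cont: "continuous_on {a..b} (P x i)"
    if "i \<in> I" "\<And>j. j \<in> I \<Longrightarrow> continuous_on {a..b} (x j)" for x i
    unfolding P_def using cont[OF that]
    by (intro continuous_intros indefinite_integral_continuous_1 integrable_continuous_real)
  have X_cont: "continuous_on {a..b} (X n i)" if "i \<in> I" for n i
    using that by (induction n arbitrary: i) (auto simp: X0[abs_def] XS intro: P_cont)
  \<comment> \<open>\<open>L'\<close> replaces a possibly nonpositive \<open>L\<close>, and
    \<open>card I + 1\<close> keeps \<open>K\<close> positive for empty \<open>I\<close>.
    Integrating a weight of rate \<open>2 * K\<close> gives a factor \<open>1 / (2 * K)\<close>;
    summing over \<open>I\<close> leaves \<open>L' * card I / (2 * K) \<le> 1/2\<close>.\<close>
  define L' where "L' = \<bar>L\<bar> + 1"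
  define K where "K = L' * (card I + 1)"
  have L': "L' > 0" by (simp add: L'_def)
  then have K: "K > 0" by (simp add: K_def)
  have lip': "\<bar>F i x t - F i y t\<bar> \<le> L' * (\<Sum>j\<in>I. \<bar>x j - y j\<bar>)"
    if "i \<in> I" "t \<in> {a..b}" for i x y t
    by (rule order_trans[OF lip[OF that]], intro mult_right_mono sum_nonneg) (auto simp: L'_def)
  define \<Delta> where "\<Delta> = (\<lambda>n i t. X (Suc n) i t - X n i t)"
  define D where "D = (\<lambda>n t. \<Sum>i\<in>I. \<bar>\<Delta> n i t\<bar>)"
  have D_cont: "continuous_on {a..b} (D n)" for n
    unfolding D_def \<Delta>_def by (intro continuous_intros X_cont)
  have "bounded (D 0 ` {a..b})"
    by (intro compact_imp_bounded compact_continuous_image D_cont compact_Icc)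
  then obtain C where "C > 0" "\<And>t. t \<in> {a..b} \<Longrightarrow> \<bar>D 0 t\<bar> \<le> C"
    by (auto simp: bounded_pos)
  then have C: "\<And>t. t \<in> {a..b} \<Longrightarrow> D 0 t \<le> C" "C > 0"
    by (auto intro: order_trans[OF abs_ge_self])
  have P_diff: "\<bar>P x i t - P y i t\<bar> \<le> integral {a..t} (\<lambda>r. L' * (\<Sum>j\<in>I. \<bar>x j r - y j r\<bar>))"
    if i: "i \<in> I" and t: "t \<in> {a..b}" and x: "\<And>j. j \<in> I \<Longrightarrow> continuous_on {a..b} (x j)"
      and y: "\<And>j. j \<in> I \<Longrightarrow> continuous_on {a..b} (y j)" for x y i t
  proof -
    have sub: "{a..t} \<subseteq> {a..b}" using t by auto
    have Fx: "(\<lambda>r. F i (\<lambda>j. x j r) r) integrable_on {a..t}"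
      by (rule integrable_continuous_real[OF continuous_on_subset[OF cont[OF i x] sub]])
    have Fy: "(\<lambda>r. F i (\<lambda>j. y j r) r) integrable_on {a..t}"
      by (rule integrable_continuous_real[OF continuous_on_subset[OF cont[OF i y] sub]])
    have "P x i t - P y i t = integral {a..t} (\<lambda>r. F i (\<lambda>j. x j r) r - F i (\<lambda>j. y j r) r)"
      using Fx Fy by (simp add: P_def integral_diff)
    moreover have "norm \<dots> \<le> integral {a..t} (\<lambda>r. L' * (\<Sum>j\<in>I. \<bar>x j r - y j r\<bar>))"
    proof (rule integral_norm_bound_integral)
      show "(\<lambda>r. F i (\<lambda>j. x j r) r - F i (\<lambda>j. y j r) r) integrable_on {a..t}"
        using Fx Fy by (rule integrable_diff)
      show "(\<lambda>r. L' * (\<Sum>j\<in>I. \<bar>x j r - y j r\<bar>)) integrable_on {a..t}"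
        by (intro integrable_continuous_real continuous_intros continuous_on_subset[OF x sub]
            continuous_on_subset[OF y sub])
    qed (use lip'[OF i] sub in auto)
    ultimately show ?thesis by simp
  qed
  have D_bound: "D n t \<le> C * (1/2) ^ n * exp (2 * K * (t - a))" if "t \<in> {a..b}" for n t
    using that
  proof (induction n arbitrary: t)
    case 0
    then have "C * 1 \<le> C * exp (2 * K * (t - a))" using C K by (intro mult_left_mono) auto
    then show ?case using C(1)[OF 0] by simp
  next
    case (Suc n)
    have each: "\<bar>\<Delta> (Suc n) i t\<bar> \<le> L' * C * (1/2) ^ n * exp (2 * K * (t - a)) / (2 * K)"
      if i: "i \<in> I" for i
    proof -
      have sub: "{a..t} \<subseteq> {a..b}" using Suc.prems by auto
      have "\<bar>\<Delta> (Suc n) i t\<bar> \<le> integral {a..t} (\<lambda>r. L' * D n r)"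
        unfolding \<Delta>_def D_def XS[of "Suc n"]
        using P_diff[OF i Suc.prems X_cont[of _ "Suc n"] X_cont[of _ n]] by (simp add: XS)
      also have "\<dots> \<le> integral {a..t} (\<lambda>r. (L' * C * (1/2) ^ n) * exp (2 * K * (r - a)))"
      proof (rule integral_le)
        show "(\<lambda>r. L' * D n r) integrable_on {a..t}"
          by (intro integrable_continuous_real continuous_intros continuous_on_subset[OF D_cont sub])
        show "(\<lambda>r. L' * C * (1/2) ^ n * exp (2 * K * (r - a))) integrable_on {a..t}"
          by (intro integrable_continuous_real continuous_intros)
        fix r assume "r \<in> {a..t}"
        then have "L' * D n r \<le> L' * (C * (1/2) ^ n * exp (2 * K * (r - a)))"
          using Suc.IH[of r] Suc.prems L' by (intro mult_left_mono) auto
        then show "L' * D n r \<le> L' * C * (1/2) ^ n * exp (2 * K * (r - a))"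
          by (simp add: mult_ac)
      qed
      also have "\<dots> \<le> L' * C * (1/2) ^ n * exp (2 * K * (t - a)) / (2 * K)"
        using Suc.prems K L' C by (intro exp_integral_le) auto
      finally show ?thesis .
    qed
    have "D (Suc n) t \<le> card I * (L' * C * (1/2) ^ n * exp (2 * K * (t - a)) / (2 * K))"
      unfolding D_def using sum_mono[OF each, of I] by simp
    also have "\<dots> = (L' * card I / K) * (C * (1/2) ^ Suc n * exp (2 * K * (t - a)))"
      by (simp add: field_simps)
    also have "\<dots> \<le> 1 * (C * (1/2) ^ Suc n * exp (2 * K * (t - a)))"
      using K L' C by (intro mult_right_mono) (auto simp: K_def)
    finally show ?case by simp
  qed
  \<comment> \<open>Writing the limit as a telescoping series lets the geometric majorant from
    \<open>D_bound\<close> enter through the Weierstrass test.\<close>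
  define x where "x = (\<lambda>i t. x0 i + (\<Sum>n. \<Delta> n i t))"
  have telescope: "x0 i + (\<Sum>m<n. \<Delta> m i t) = X n i t" for n i t
    using sum_lessThan_telescope[of "\<lambda>m. X m i t" n] by (simp add: \<Delta>_def X0)
  have ulim: "uniform_limit {a..b} (\<lambda>n. X n i) (x i) sequentially" if i: "i \<in> I" for i
  proof -
    have "uniform_limit {a..b} (\<lambda>n t. \<Sum>m<n. \<Delta> m i t) (\<lambda>t. \<Sum>m. \<Delta> m i t) sequentially"
    proof (rule Weierstrass_m_test)
      fix n t assume t: "t \<in> {a..b}"
      have "\<bar>\<Delta> n i t\<bar> \<le> D n t"
        unfolding D_def by (rule member_le_sum) (auto simp: fin i)
      also have "\<dots> \<le> C * (1/2) ^ n * exp (2 * K * (t - a))" by (rule D_bound[OF t])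
      also have "\<dots> \<le> C * (1/2) ^ n * exp (2 * K * (b - a))"
        using t K C by (intro mult_left_mono) auto
      finally show "norm (\<Delta> n i t) \<le> C * (1/2) ^ n * exp (2 * K * (b - a))" by simp
    qed (auto intro!: summable_mult summable_mult2 summable_geometric)
    then have "uniform_limit {a..b} (\<lambda>n t. x0 i + (\<Sum>m<n. \<Delta> m i t)) (x i) sequentially"
      unfolding x_def by (intro uniform_limit_intros)
    then show ?thesis by (simp add: telescope)
  qed
  have x_cont: "continuous_on {a..b} (x i)" if "i \<in> I" for i
    by (rule uniform_limit_theorem[OF _ ulim[OF that]])
      (auto intro!: always_eventually X_cont that)
  \<comment> \<open>The iterates \<open>X (Suc n) = P (X n)\<close> tend to \<open>x\<close> and
    also to \<open>P x\<close>, because \<open>P_diff\<close> bounds the distance to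
    \<open>P x\<close> by the integral of a uniformly vanishing error.\<close>
  have fixpoint: "x i t = P x i t" if i: "i \<in> I" and t: "t \<in> {a..b}" for i t
  proof (rule LIMSEQ_unique)
    have "(\<lambda>n. X n i t) \<longlonglongrightarrow> x i t" by (rule tendsto_uniform_limitI[OF ulim[OF i] t])
    then show "(\<lambda>n. X (Suc n) i t) \<longlonglongrightarrow> x i t" by (rule LIMSEQ_Suc)
    have "uniform_limit {a..b} (\<lambda>n r. L' * (\<Sum>j\<in>I. \<bar>X n j r - x j r\<bar>)) (\<lambda>r. 0) sequentially"
    proof -
      have "uniform_limit {a..b} (\<lambda>n r. \<Sum>j\<in>I. \<bar>X n j r - x j r\<bar>) (\<lambda>r. \<Sum>j\<in>I. 0) sequentially"
        by (rule uniform_limit_sum)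
          (use ulim in \<open>simp add: uniform_limit_iff dist_real_def\<close>)
      then have "uniform_limit {a..b} (\<lambda>n r. L' * (\<Sum>j\<in>I. \<bar>X n j r - x j r\<bar>))
          (\<lambda>r. L' * (\<Sum>j\<in>I. 0)) sequentially"
        by (rule bounded_linear.uniform_limit[OF bounded_linear_mult_right])
      then show ?thesis by simp
    qed
    then have "uniform_limit {a..t} (\<lambda>n r. L' * (\<Sum>j\<in>I. \<bar>X n j r - x j r\<bar>)) (\<lambda>r. 0) sequentially"
      by (rule uniform_limit_on_subset) (use t in auto)
    then have lim0: "(\<lambda>n. integral {a..t} (\<lambda>r. L' * (\<Sum>j\<in>I. \<bar>X n j r - x j r\<bar>))) \<longlonglongrightarrow> 0"
    proof (rule uniform_limit_integral)
      fix n
      have "continuous_on {a..t} (X n j)" "continuous_on {a..t} (x j)" if "j \<in> I" for j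
        by (rule continuous_on_subset[of "{a..b}"]; use that t in \<open>force intro: X_cont x_cont\<close>)+
      then show "continuous_on {a..t} (\<lambda>r. L' * (\<Sum>j\<in>I. \<bar>X n j r - x j r\<bar>))"
        by (intro continuous_intros)
    next
      fix Q J
      assume Q: "\<And>n. ((\<lambda>r. L' * (\<Sum>j\<in>I. \<bar>X n j r - x j r\<bar>)) has_integral Q n) {a..t}"
        and J: "((\<lambda>r. 0) has_integral J) {a..t}" and "Q \<longlonglongrightarrow> J"
      moreover have "J = 0" using J by simp
      moreover have "Q n = integral {a..t} (\<lambda>r. L' * (\<Sum>j\<in>I. \<bar>X n j r - x j r\<bar>))" for n
        using integral_unique[OF Q] by (rule sym)
      then have "Q = (\<lambda>n. integral {a..t} (\<lambda>r. L' * (\<Sum>j\<in>I. \<bar>X n j r - x j r\<bar>)))" ..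
      ultimately show ?thesis by (simp only:)
    qed simp_all
    have "(\<lambda>n. X (Suc n) i t - P x i t) \<longlonglongrightarrow> 0"
      by (rule Lim_null_comparison[OF _ lim0])
        (use P_diff[OF i t X_cont x_cont] in \<open>simp add: XS\<close>)
    then show "(\<lambda>n. X (Suc n) i t) \<longlonglongrightarrow> P x i t" by (simp add: LIM_zero_iff)
  qed
  show ?thesis
  proof (rule that)
    show "x i a = x0 i" if "i \<in> I" for i
      using fixpoint[OF that, of a] ab by (simp add: P_def)
    show "(x i has_real_derivative F i (\<lambda>j. x j t) t) (at t within {a..b})"
      if i: "i \<in> I" and t: "t \<in> {a..b}" for i t
    \<comment> \<open>The radius 1 is arbitrary: \<open>x i\<close> and \<open>P x i\<close> agree
      on the whole interval.\<close>
    proof (rule has_field_derivative_transform_within[OF _ zero_less_one t])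
      show "(P x i has_real_derivative F i (\<lambda>j. x j t) t) (at t within {a..b})"
        unfolding P_def
        by (rule derivative_eq_intros integral_has_real_derivative[OF cont[OF i x_cont] t] refl | simp)+
    qed (use fixpoint[OF i] in auto)
  qed
qed

section \<open>Functions that are Lipschitz on boxes\<close>

definition sup_box :: "'a set \<Rightarrow> real \<Rightarrow> ('a \<Rightarrow> real) set" where
  "sup_box I M = {x. \<forall>j\<in>I. \<bar>x j\<bar> \<le> M}"

text \<open>Boundedness is part of the notion so that it is stable under products. Since
  \<open>sup_box\<close> leaves coordinates outside \<open>I\<close> free, the estimate also forces
  \<open>h\<close> to ignore them on the box.\<close>

definition box_lipschitz :: "'a set \<Rightarrow> real \<Rightarrow> (('a \<Rightarrow> real) \<Rightarrow> real) \<Rightarrow> bool" where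
  "box_lipschitz I M h \<longleftrightarrow> (\<exists>B L. \<forall>x\<in>sup_box I M. \<forall>y\<in>sup_box I M.
     \<bar>h x\<bar> \<le> B \<and> \<bar>h x - h y\<bar> \<le> L * (\<Sum>j\<in>I. \<bar>x j - y j\<bar>))"

lemma box_lipschitzI:
  assumes "\<And>x. x \<in> sup_box I M \<Longrightarrow> \<bar>h x\<bar> \<le> B"
    and "\<And>x y. x \<in> sup_box I M \<Longrightarrow> y \<in> sup_box I M \<Longrightarrow>
       \<bar>h x - h y\<bar> \<le> L * (\<Sum>j\<in>I. \<bar>x j - y j\<bar>)"
  shows "box_lipschitz I M h"
  unfolding box_lipschitz_def using assms by blast

lemma box_lipschitzE:
  assumes "box_lipschitz I M h"
  obtains B L where "B \<ge> 0" and "L \<ge> 0" and "\<And>x. x \<in> sup_box I M \<Longrightarrow> \<bar>h x\<bar> \<le> B"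
    and "\<And>x y. x \<in> sup_box I M \<Longrightarrow> y \<in> sup_box I M \<Longrightarrow>
       \<bar>h x - h y\<bar> \<le> L * (\<Sum>j\<in>I. \<bar>x j - y j\<bar>)"
proof -
  obtain B L where *: "\<bar>h x\<bar> \<le> B" "\<bar>h x - h y\<bar> \<le> L * (\<Sum>j\<in>I. \<bar>x j - y j\<bar>)"
    if "x \<in> sup_box I M" "y \<in> sup_box I M" for x y
    using assms unfolding box_lipschitz_def by blast
  show ?thesis
  proof (rule that[of "\<bar>B\<bar>" "\<bar>L\<bar>"])
    show "\<bar>h x\<bar> \<le> \<bar>B\<bar>" if "x \<in> sup_box I M" for x
      using *(1)[OF that that] by linarith
  next
    fix x y assume "x \<in> sup_box I M" "y \<in> sup_box I M"
    then have "\<bar>h x - h y\<bar> \<le> L * (\<Sum>j\<in>I. \<bar>x j - y j\<bar>)" by (rule *)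
    also have "\<dots> \<le> \<bar>L\<bar> * (\<Sum>j\<in>I. \<bar>x j - y j\<bar>)"
      by (intro mult_right_mono sum_nonneg) auto
    finally show "\<bar>h x - h y\<bar> \<le> \<bar>L\<bar> * (\<Sum>j\<in>I. \<bar>x j - y j\<bar>)" .
  qed auto
qed

named_theorems box_lipschitz_intros

lemma box_lipschitz_const [box_lipschitz_intros]: "box_lipschitz I M (\<lambda>_. c)"
  by (rule box_lipschitzI[where L = 0]) auto

lemma box_lipschitz_coord [box_lipschitz_intros]:
  assumes "finite I" "j \<in> I"
  shows "box_lipschitz I M (\<lambda>x. x j)"
proof (rule box_lipschitzI[where B = M and L = 1])
  show "\<bar>x j - y j\<bar> \<le> 1 * (\<Sum>j\<in>I. \<bar>x j - y j\<bar>)" for x y :: "'a \<Rightarrow> real"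
    using member_le_sum[of j I "\<lambda>j. \<bar>x j - y j\<bar>"] assms by simp
qed (use assms in \<open>auto simp: sup_box_def\<close>)

lemma box_lipschitz_add [box_lipschitz_intros]:
  assumes "box_lipschitz I M g" "box_lipschitz I M h"
  shows "box_lipschitz I M (\<lambda>x. g x + h x)"
  using assms(1)
proof (rule box_lipschitzE)
  fix B L
  assume g: "\<And>x. x \<in> sup_box I M \<Longrightarrow> \<bar>g x\<bar> \<le> B"
    "\<And>x y. x \<in> sup_box I M \<Longrightarrow> y \<in> sup_box I M \<Longrightarrow> \<bar>g x - g y\<bar> \<le> L * (\<Sum>j\<in>I. \<bar>x j - y j\<bar>)"
  from assms(2) show ?thesis
  proof (rule box_lipschitzE)
    fix B' L'
    assume h: "\<And>x. x \<in> sup_box I M \<Longrightarrow> \<bar>h x\<bar> \<le> B'"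
      "\<And>x y. x \<in> sup_box I M \<Longrightarrow> y \<in> sup_box I M \<Longrightarrow> \<bar>h x - h y\<bar> \<le> L' * (\<Sum>j\<in>I. \<bar>x j - y j\<bar>)"
    show ?thesis
    proof (rule box_lipschitzI[where B = "B + B'" and L = "L + L'"])
      show "\<bar>g x + h x\<bar> \<le> B + B'" if "x \<in> sup_box I M" for x
        using g(1)[OF that] h(1)[OF that] by linarith
      fix x y assume xy: "x \<in> sup_box I M" "y \<in> sup_box I M"
      show "\<bar>g x + h x - (g y + h y)\<bar> \<le> (L + L') * (\<Sum>j\<in>I. \<bar>x j - y j\<bar>)"
        using g(2)[OF xy] h(2)[OF xy] unfolding distrib_right by linarith
    qed
  qed
qed

lemma box_lipschitz_mult [box_lipschitz_intros]:
  assumes "box_lipschitz I M g" "box_lipschitz I M h"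
  shows "box_lipschitz I M (\<lambda>x. g x * h x)"
  using assms(1)
proof (rule box_lipschitzE)
  fix B L
  assume B: "B \<ge> 0" and g: "\<And>x. x \<in> sup_box I M \<Longrightarrow> \<bar>g x\<bar> \<le> B"
    "\<And>x y. x \<in> sup_box I M \<Longrightarrow> y \<in> sup_box I M \<Longrightarrow> \<bar>g x - g y\<bar> \<le> L * (\<Sum>j\<in>I. \<bar>x j - y j\<bar>)"
  from assms(2) show ?thesis
  proof (rule box_lipschitzE)
    fix B' L'
    assume h: "\<And>x. x \<in> sup_box I M \<Longrightarrow> \<bar>h x\<bar> \<le> B'"
      "\<And>x y. x \<in> sup_box I M \<Longrightarrow> y \<in> sup_box I M \<Longrightarrow> \<bar>h x - h y\<bar> \<le> L' * (\<Sum>j\<in>I. \<bar>x j - y j\<bar>)"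
    show ?thesis
    proof (rule box_lipschitzI[where B = "B * B'" and L = "B * L' + L * B'"])
      show "\<bar>g x * h x\<bar> \<le> B * B'" if "x \<in> sup_box I M" for x
        unfolding abs_mult using g(1)[OF that] h(1)[OF that] B by (intro mult_mono) auto
      fix x y assume xy: "x \<in> sup_box I M" "y \<in> sup_box I M"
      let ?S = "\<Sum>j\<in>I. \<bar>x j - y j\<bar>"
      have "g x * h x - g y * h y = g x * (h x - h y) + (g x - g y) * h y"
        by (simp add: algebra_simps)
      also have "\<bar>\<dots>\<bar> \<le> \<bar>g x\<bar> * \<bar>h x - h y\<bar> + \<bar>g x - g y\<bar> * \<bar>h y\<bar>"
        by (simp add: abs_mult[symmetric] abs_triangle_ineq)
      also have "\<dots> \<le> B * (L' * ?S) + (L * ?S) * B'"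
      proof (intro add_mono mult_mono)
        show "0 \<le> L * ?S" using g(2)[OF xy] by (rule order_trans[OF abs_ge_zero])
      qed (use g(1)[OF xy(1)] g(2)[OF xy] h(1)[OF xy(2)] h(2)[OF xy] B in auto)
      finally show "\<bar>g x * h x - g y * h y\<bar> \<le> (B * L' + L * B') * ?S"
        by (simp add: algebra_simps)
    qed
  qed
qed

lemma box_lipschitz_diff [box_lipschitz_intros]:
  assumes "box_lipschitz I M g" "box_lipschitz I M h"
  shows "box_lipschitz I M (\<lambda>x. g x - h x)"
  using box_lipschitz_add[OF assms(1) box_lipschitz_mult[OF box_lipschitz_const assms(2), of "-1"]]
  by simp

lemma box_lipschitz_max [box_lipschitz_intros]:
  assumes "box_lipschitz I M g"
  shows "box_lipschitz I M (\<lambda>x. max (g x) c)"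
  using assms
proof (rule box_lipschitzE)
  fix B L
  assume g: "\<And>x. x \<in> sup_box I M \<Longrightarrow> \<bar>g x\<bar> \<le> B"
    "\<And>x y. x \<in> sup_box I M \<Longrightarrow> y \<in> sup_box I M \<Longrightarrow> \<bar>g x - g y\<bar> \<le> L * (\<Sum>j\<in>I. \<bar>x j - y j\<bar>)"
  show ?thesis
  proof (rule box_lipschitzI[where B = "B + \<bar>c\<bar>" and L = L])
    show "\<bar>max (g x) c\<bar> \<le> B + \<bar>c\<bar>" if "x \<in> sup_box I M" for x
      using g(1)[OF that] by linarith
    show "\<bar>max (g x) c - max (g y) c\<bar> \<le> L * (\<Sum>j\<in>I. \<bar>x j - y j\<bar>)"
      if "x \<in> sup_box I M" "y \<in> sup_box I M" for x y
      using g(2)[OF that] by linarith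
  qed
qed

lemma box_lipschitz_sum [box_lipschitz_intros]:
  assumes "\<And>k. k \<in> A \<Longrightarrow> box_lipschitz I M (h k)"
  shows "box_lipschitz I M (\<lambda>x. \<Sum>k\<in>A. h k x)"
  using assms
  by (induction A rule: infinite_finite_induct) (auto intro: box_lipschitz_intros)

lemma box_lipschitz_uniform:
  assumes fin: "finite A" and h: "\<And>k. k \<in> A \<Longrightarrow> box_lipschitz I M (h k)"
  obtains L where "L \<ge> 0" and "\<And>k x y. k \<in> A \<Longrightarrow> x \<in> sup_box I M \<Longrightarrow> y \<in> sup_box I M \<Longrightarrow>
       \<bar>h k x - h k y\<bar> \<le> L * (\<Sum>j\<in>I. \<bar>x j - y j\<bar>)"
proof -
  have "\<forall>k\<in>A. \<exists>L\<ge>0. \<forall>x\<in>sup_box I M. \<forall>y\<in>sup_box I M.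
      \<bar>h k x - h k y\<bar> \<le> L * (\<Sum>j\<in>I. \<bar>x j - y j\<bar>)"
  proof
    fix k assume "k \<in> A"
    from h[OF this] show "\<exists>L\<ge>0. \<forall>x\<in>sup_box I M. \<forall>y\<in>sup_box I M.
      \<bar>h k x - h k y\<bar> \<le> L * (\<Sum>j\<in>I. \<bar>x j - y j\<bar>)"
      by (rule box_lipschitzE) blast
  qed
  from bchoice[OF this] obtain l where l: "\<And>k. k \<in> A \<Longrightarrow> l k \<ge> 0"
    "\<And>k x y. k \<in> A \<Longrightarrow> x \<in> sup_box I M \<Longrightarrow> y \<in> sup_box I M \<Longrightarrow>
      \<bar>h k x - h k y\<bar> \<le> l k * (\<Sum>j\<in>I. \<bar>x j - y j\<bar>)"
    by blast
  \<comment> \<open>The sum of the constants dominates each of them and, unlike a maximum, is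
    defined for an empty family.\<close>
  show ?thesis
  proof (rule that[of "sum l A"])
    fix k x y assume k: "k \<in> A" and xy: "x \<in> sup_box I M" "y \<in> sup_box I M"
    have "l k \<le> sum l A" using k l(1) fin by (intro member_le_sum) auto
    then have "l k * (\<Sum>j\<in>I. \<bar>x j - y j\<bar>) \<le> sum l A * (\<Sum>j\<in>I. \<bar>x j - y j\<bar>)"
      by (intro mult_right_mono sum_nonneg) auto
    with l(2)[OF k xy] show "\<bar>h k x - h k y\<bar> \<le> sum l A * (\<Sum>j\<in>I. \<bar>x j - y j\<bar>)" by linarith
  qed (use l(1) in \<open>auto intro: sum_nonneg\<close>)
qed

lemma box_lipschitz_continuous_on:
  assumes h: "box_lipschitz I M h"
    and x: "\<And>j. j \<in> I \<Longrightarrow> continuous_on S (x j)"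
    and M: "\<And>t. t \<in> S \<Longrightarrow> (\<lambda>j. x j t) \<in> sup_box I M"
  shows "continuous_on S (\<lambda>t. h (\<lambda>j. x j t))"
  using h
proof (rule box_lipschitzE)
  fix L assume L: "\<And>x y. x \<in> sup_box I M \<Longrightarrow> y \<in> sup_box I M \<Longrightarrow>
    \<bar>h x - h y\<bar> \<le> L * (\<Sum>j\<in>I. \<bar>x j - y j\<bar>)"
  show ?thesis
    unfolding continuous_on
  proof
    fix t assume t: "t \<in> S"
    have "((\<lambda>s. L * (\<Sum>j\<in>I. \<bar>x j s - x j t\<bar>)) \<longlongrightarrow> L * (\<Sum>j\<in>I. \<bar>x j t - x j t\<bar>)) (at t within S)"
      using x t unfolding continuous_on by (intro tendsto_intros) auto
    then have lim0: "((\<lambda>s. L * (\<Sum>j\<in>I. \<bar>x j s - x j t\<bar>)) \<longlongrightarrow> 0) (at t within S)" by simp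
    have "((\<lambda>s. h (\<lambda>j. x j s) - h (\<lambda>j. x j t)) \<longlongrightarrow> 0) (at t within S)"
    proof (rule Lim_null_comparison[OF _ lim0])
      show "\<forall>\<^sub>F s in at t within S.
          norm (h (\<lambda>j. x j s) - h (\<lambda>j. x j t)) \<le> L * (\<Sum>j\<in>I. \<bar>x j s - x j t\<bar>)"
        unfolding eventually_at_filter
        using L M t by (auto intro!: always_eventually)
    qed
    then show "((\<lambda>s. h (\<lambda>j. x j s)) \<longlongrightarrow> h (\<lambda>j. x j t)) (at t within S)"
      by (simp add: LIM_zero_iff)
  qed
qed

section \<open>Solution of the reduced system\<close>

text \<open>The sign is that of \<open>- u'\<close>, so that in reversed time the system is an
  initial value problem with this field.\<close>

definition ode_rhs ::
  "nat \<Rightarrow> real \<Rightarrow> (nat \<Rightarrow> real \<Rightarrow> real) \<Rightarrow> (nat \<Rightarrow> nat \<Rightarrow> real \<Rightarrow> real) \<Rightarrow> nat \<Rightarrow> nat \<Rightarrow> real \<Rightarrow> real"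
  where "ode_rhs N eta f u i n t = f i (real n / real N) - (alpha_star u i n t)\<^sup>2 / 2
     + eta * (u (1 - i) n t - u i n t)
     + gamma_plus N eta u i n t * (u i (n + 1) t - u i n t)
     + gamma_minus eta u i n t * (u i (n - 1) t - u i n t)"

lemma ode_solution_iff:
  "ode_solution N eta f psi T u \<longleftrightarrow> (\<forall>i\<in>{0, 1}. \<forall>n\<le>N. u i n T = psi i (real n / real N) \<and>
     (\<forall>t\<in>{0..T}. (u i n has_real_derivative - ode_rhs N eta f u i n t) (at t within {0..T})))"
  unfolding ode_solution_def ode_rhs_def by simp

text \<open>This reduces the system to the finitely many unknowns indexed by \<open>{0, 1}\<close>
  and \<open>{..N}\<close>. Truncated subtraction keeps the lower indices in range, so only
  \<open>n = N\<close> needs care, and there the factor of the upward jump vanishes. Two different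
  times are allowed because the field is autonomous: this serves both time reversal and freezing the
  unknowns.\<close>

lemma ode_rhs_cong:
  assumes eq: "\<And>j m. j \<in> {0, 1} \<Longrightarrow> m \<le> N \<Longrightarrow> u j m t = w j m s"
    and i: "i \<in> {0, 1}" and n: "n \<le> N"
  shows "ode_rhs N eta f u i n t = ode_rhs N eta f w i n s"
proof -
  have alpha: "alpha_star u j m t = alpha_star w j m s" if "j \<in> {0, 1}" "m \<le> N" for j m
    using eq[OF that] eq[of "1 - j" m] that by (auto simp: alpha_star_def)
  have "gamma_plus N eta u i n t * (u i (n + 1) t - u i n t) =
      gamma_plus N eta w i n s * (w i (n + 1) s - w i n s)"
  proof (cases "n = N")
    case False
    then show ?thesis
      using i n eq[OF i, of "n + 1"] eq[OF i n] alpha[of 1 "n + 1 - i"]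
      by (simp add: gamma_plus_def)
  qed (simp add: gamma_plus_def)
  moreover have "gamma_minus eta u i n t * (u i (n - 1) t - u i n t) =
      gamma_minus eta w i n s * (w i (n - 1) s - w i n s)"
    using i n eq[OF i, of "n - 1"] eq[OF i n] alpha[of 0 "n - i"]
    by (simp add: gamma_minus_def)
  ultimately show ?thesis
    unfolding ode_rhs_def using i n eq[OF i n] eq[of "1 - i" n] alpha[OF i n] by auto
qed

section \<open>Maximum principle for the drift\<close>

lemma gamma_plus_nonneg: "eta \<ge> 0 \<Longrightarrow> n \<le> N \<Longrightarrow> gamma_plus N eta u i n t \<ge> 0"
  and gamma_minus_nonneg: "eta \<ge> 0 \<Longrightarrow> gamma_minus eta u i n t \<ge> 0"
  by (auto simp: gamma_plus_def gamma_minus_def alpha_star_def)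

text \<open>Every jump term is a nonnegative rate times a nonpositive difference, and the quadratic
  term is subtracted, so both have the favorable sign.\<close>

lemma ode_rhs_le_at_max:
  assumes max: "\<And>j m. j \<in> {0, 1} \<Longrightarrow> m \<le> N \<Longrightarrow> u j m t \<le> u i n t"
    and i: "i \<in> {0, 1}" and n: "n \<le> N" and eta: "eta \<ge> 0"
  shows "ode_rhs N eta f u i n t \<le> f i (real n / real N)"
proof -
  have "eta * (u (1 - i) n t - u i n t) \<le> 0"
    using max[of "1 - i" n] i n eta by (auto simp: mult_le_0_iff)
  moreover have "gamma_plus N eta u i n t * (u i (n + 1) t - u i n t) \<le> 0"
  proof (cases "n = N")
    case False
    then show ?thesis using max[OF i, of "n + 1"] gamma_plus_nonneg[OF eta n] n
      by (auto simp: mult_le_0_iff)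
  qed (simp add: gamma_plus_def)
  moreover have "gamma_minus eta u i n t * (u i (n - 1) t - u i n t) \<le> 0"
    using max[OF i, of "n - 1"] gamma_minus_nonneg[OF eta] n by (auto simp: mult_le_0_iff)
  moreover have "(alpha_star u i n t)\<^sup>2 / 2 \<ge> 0" by simp
  ultimately show ?thesis unfolding ode_rhs_def by linarith
qed

text \<open>Here the quadratic term has the wrong sign, but it vanishes: at a minimum there is
  nothing to gain from switching the own state.\<close>

lemma ode_rhs_ge_at_min:
  assumes min: "\<And>j m. j \<in> {0, 1} \<Longrightarrow> m \<le> N \<Longrightarrow> u i n t \<le> u j m t"
    and i: "i \<in> {0, 1}" and n: "n \<le> N" and eta: "eta \<ge> 0"
  shows "f i (real n / real N) \<le> ode_rhs N eta f u i n t"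
proof -
  have min': "u i n t \<le> u (1 - i) n t" using min[of "1 - i" n] i n by auto
  then have "0 \<le> eta * (u (1 - i) n t - u i n t)" using eta by simp
  moreover have "0 \<le> gamma_plus N eta u i n t * (u i (n + 1) t - u i n t)"
  proof (cases "n = N")
    case False
    then show ?thesis using min[OF i, of "n + 1"] gamma_plus_nonneg[OF eta n] n by auto
  qed (simp add: gamma_plus_def)
  moreover have "0 \<le> gamma_minus eta u i n t * (u i (n - 1) t - u i n t)"
    using min[OF i, of "n - 1"] gamma_minus_nonneg[OF eta] n by auto
  moreover have "alpha_star u i n t = 0" using min' by (simp add: alpha_star_def)
  ultimately show ?thesis unfolding ode_rhs_def by simp
qed

lemma ode_rhs_box_lipschitz:
  assumes i: "i \<in> {0, 1}" and n: "n \<le> N"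
  shows "box_lipschitz ({0, 1} \<times> {..N}) M (\<lambda>x. ode_rhs N eta f (\<lambda>j m _. x (j, m)) i n t)"
proof -
  note coord = box_lipschitz_coord[where I = "{0, 1} \<times> {..N}" and M = M, OF finite_cartesian_product]
  have plus: "box_lipschitz ({0, 1} \<times> {..N}) M
      (\<lambda>x. gamma_plus N eta (\<lambda>j m _. x (j, m)) i n t * (x (i, n + 1) - x (i, n)))"
  \<comment> \<open>For \<open>n = N\<close> the coordinate \<open>(i, n + 1)\<close> lies outside
    the index set, and only the vanishing factor saves the estimate.\<close>
  proof (cases "n = N")
    case True
    then show ?thesis by (simp add: gamma_plus_def box_lipschitz_const)
  next
    case False
    then show ?thesis using i n unfolding gamma_plus_def alpha_star_def
      by (intro box_lipschitz_intros) auto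
  qed
  have minus: "box_lipschitz ({0, 1} \<times> {..N}) M
      (\<lambda>x. gamma_minus eta (\<lambda>j m _. x (j, m)) i n t * (x (i, n - 1) - x (i, n)))"
    using i n unfolding gamma_minus_def alpha_star_def by (intro box_lipschitz_intros) auto
  have "box_lipschitz ({0, 1} \<times> {..N}) M (\<lambda>x. alpha_star (\<lambda>j m _. x (j, m)) i n t)"
    using i n unfolding alpha_star_def by (intro box_lipschitz_intros) auto
  then have quadratic: "box_lipschitz ({0, 1} \<times> {..N}) M
      (\<lambda>x. (alpha_star (\<lambda>j m _. x (j, m)) i n t)\<^sup>2 / 2)"
    unfolding power2_eq_square divide_inverse by (intro box_lipschitz_intros)
  show ?thesis
    unfolding ode_rhs_def
    by (intro box_lipschitz_add box_lipschitz_diff plus minus quadratic box_lipschitz_const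
        box_lipschitz_mult coord) (use i n in auto)
qed

section \<open>Global existence by clipping\<close>

lemma admissible_data_bounded:
  assumes "admissible_data g" "N \<ge> 1"
  obtains B where "B \<ge> 0"
    and "\<And>i n. i \<in> {0, 1} \<Longrightarrow> n \<le> N \<Longrightarrow> \<bar>g i (real n / real N)\<bar> \<le> B"
proof -
  obtain B where B: "B > 0" "\<forall>y\<in>{g i x | i x. i \<in> {0, 1} \<and> x \<in> {0..1}}. norm y \<le> B"
    using assms(1) unfolding admissible_data_def bounded_pos by blast
  show ?thesis
  proof (rule that[of B])
    fix i n :: nat assume "i \<in> {0, 1}" "n \<le> N"
    moreover have "real n / real N \<in> {0..1}" using \<open>n \<le> N\<close> assms(2) by (simp add: divide_le_eq)
    ultimately have "norm (g i (real n / real N)) \<le> B" using B(2) by blast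
    then show "\<bar>g i (real n / real N)\<bar> \<le> B" by simp
  qed (use B in simp)
qed

text \<open>
  The right-hand side is only locally Lipschitz. Clipping the unknown at the a priori bound
  \<open>A + B * (T - t)\<close> makes it globally Lipschitz; a component that crosses the bound is, after
  clipping, extremal among all components, so that its drift is at most \<open>B\<close> in modulus.
  Hence the clipping is never active.
\<close>

theorem ode_solution_exists:
  fixes T eta :: real
  assumes T: "T > 0" and eta: "eta \<ge> 0" and N: "N \<ge> 1"
    and f: "admissible_data f" and psi: "admissible_data psi"
  shows "\<exists>u. ode_solution N eta f psi T u"
proof -
  define I where "I = {0, 1 :: nat} \<times> {..N}"
  have finI: "finite I" by (simp add: I_def)
  obtain A where A: "A \<ge> 0" "\<And>i n. i \<in> {0, 1} \<Longrightarrow> n \<le> N \<Longrightarrow> \<bar>psi i (real n / real N)\<bar> \<le> A"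
    by (rule admissible_data_bounded[OF psi N]) blast
  obtain B where B: "B \<ge> 0" "\<And>i n. i \<in> {0, 1} \<Longrightarrow> n \<le> N \<Longrightarrow> \<bar>f i (real n / real N)\<bar> \<le> B"
    by (rule admissible_data_bounded[OF f N]) blast
  \<comment> \<open>Time runs backward here: the bound starts from \<open>A\<close>, which bounds
    the terminal data, and grows at the rate \<open>B\<close>, which bounds the running
    cost.\<close>
  define M where "M = (\<lambda>t. A + B * t)"
  define clip where "clip = (\<lambda>t y. max (min y (M t)) (- M t))"
  \<comment> \<open>The time argument 0 is a dummy, since the unknowns enter as functions constant
    in time.\<close>
  define h where "h = (\<lambda>p (x :: nat \<times> nat \<Rightarrow> real). ode_rhs N eta f (\<lambda>j m _. x (j, m)) (fst p) (snd p) 0)"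
  define F where "F = (\<lambda>p x t. h p (\<lambda>q. clip t (x q)))"
  have M: "0 \<le> M t" "M t \<le> M T" if "t \<in> {0..T}" for t
    using that A B by (auto simp: M_def intro: mult_left_mono)
  have clip_bound: "\<bar>clip t y\<bar> \<le> M t" if "t \<in> {0..T}" for t y
    using M[OF that] by (auto simp: clip_def)
  have clip_box: "(\<lambda>q. clip t (x q)) \<in> sup_box I (M T)" if "t \<in> {0..T}" for t x
    using clip_bound[OF that] M(2)[OF that] by (fastforce simp: sup_box_def intro: order_trans)
  have clip_lip: "\<bar>clip t y - clip t z\<bar> \<le> \<bar>y - z\<bar>" for t y z
    by (auto simp: clip_def)
  have h: "box_lipschitz I (M T) (h p)" if "p \<in> I" for p
    unfolding h_def I_def by (rule ode_rhs_box_lipschitz) (use that in \<open>auto simp: I_def\<close>)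
  obtain L where L: "L \<ge> 0" "\<And>p x y. p \<in> I \<Longrightarrow> x \<in> sup_box I (M T) \<Longrightarrow> y \<in> sup_box I (M T) \<Longrightarrow>
      \<bar>h p x - h p y\<bar> \<le> L * (\<Sum>q\<in>I. \<bar>x q - y q\<bar>)"
    using box_lipschitz_uniform[where h = h, OF finI h] by blast
  obtain y where y0: "\<And>p. p \<in> I \<Longrightarrow> y p 0 = psi (fst p) (real (snd p) / real N)"
    and y': "\<And>p t. p \<in> I \<Longrightarrow> t \<in> {0..T} \<Longrightarrow>
      (y p has_real_derivative F p (\<lambda>q. y q t) t) (at t within {0..T})"
  proof (rule picard_lindelof_finite[of I 0 T F L "\<lambda>p. psi (fst p) (real (snd p) / real N)"])
    fix p x z t assume p: "p \<in> I" and t: "t \<in> {0..T}"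
    have "\<bar>F p x t - F p z t\<bar> \<le> L * (\<Sum>q\<in>I. \<bar>clip t (x q) - clip t (z q)\<bar>)"
      unfolding F_def by (rule L(2)[OF p clip_box[OF t] clip_box[OF t]])
    also have "\<dots> \<le> L * (\<Sum>q\<in>I. \<bar>x q - z q\<bar>)"
      by (intro mult_left_mono sum_mono clip_lip L(1))
    finally show "\<bar>F p x t - F p z t\<bar> \<le> L * (\<Sum>q\<in>I. \<bar>x q - z q\<bar>)" .
  next
    fix p and x :: "nat \<times> nat \<Rightarrow> real \<Rightarrow> real"
    assume p: "p \<in> I" and x: "\<And>q. q \<in> I \<Longrightarrow> continuous_on {0..T} (x q)"
    show "continuous_on {0..T} (\<lambda>t. F p (\<lambda>q. x q t) t)"
      unfolding F_def
    proof (rule box_lipschitz_continuous_on[where x = "\<lambda>q t. clip t (x q t)", OF h[OF p] _ clip_box])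
      show "continuous_on {0..T} (\<lambda>t. clip t (x q t))" if "q \<in> I" for q
        unfolding clip_def M_def by (intro continuous_intros x that)
    qed
  qed (use finI T that in auto)
  have M_der: "(M has_real_derivative B) (at t within {0..T})" for t
    unfolding M_def by (auto intro!: derivative_eq_intros)
  have upper: "y p t - M t \<le> 0" if p: "p \<in> I" and t: "t \<in> {0..T}" for p t
  proof (rule barrier_nonpos[OF _ _ _ t])
    show "((\<lambda>t. y p t - M t) has_real_derivative F p (\<lambda>q. y q t) t - B) (at t within {0..T})"
      if "t \<in> {0..T}" for t
      by (intro DERIV_diff y'[OF p that] M_der)
    show "y p 0 - M 0 \<le> 0"
      using y0[OF p] A(2)[of "fst p" "snd p"] p by (auto simp: M_def I_def)
    fix t assume t: "t \<in> {0..T}" and above: "0 < y p t - M t"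
    have "clip t (y p t) = M t" using above M(1)[OF t] by (simp add: clip_def)
    then have "F p (\<lambda>q. y q t) t \<le> f (fst p) (real (snd p) / real N)"
      unfolding F_def h_def
      by (intro ode_rhs_le_at_max) (use p clip_bound[OF t] eta in \<open>auto simp: I_def abs_le_iff\<close>)
    also have "\<dots> \<le> B" using B(2)[of "fst p" "snd p"] p by (auto simp: I_def)
    finally show "F p (\<lambda>q. y q t) t - B \<le> 0" by simp
  qed
  have lower: "- y p t - M t \<le> 0" if p: "p \<in> I" and t: "t \<in> {0..T}" for p t
  proof (rule barrier_nonpos[OF _ _ _ t])
    show "((\<lambda>t. - y p t - M t) has_real_derivative - F p (\<lambda>q. y q t) t - B) (at t within {0..T})"
      if "t \<in> {0..T}" for t
      by (intro DERIV_diff DERIV_minus y'[OF p that] M_der)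
    show "- y p 0 - M 0 \<le> 0"
      using y0[OF p] A(2)[of "fst p" "snd p"] p by (auto simp: M_def I_def)
    fix t assume t: "t \<in> {0..T}" and below: "0 < - y p t - M t"
    have "clip t (y p t) = - M t" using below M(1)[OF t] by (simp add: clip_def)
    moreover have "- M t \<le> clip t z" for z using clip_bound[OF t, of z] by linarith
    ultimately have "f (fst p) (real (snd p) / real N) \<le> F p (\<lambda>q. y q t) t"
      unfolding F_def h_def
      by (intro ode_rhs_ge_at_min) (use p eta in \<open>auto simp: I_def\<close>)
    moreover have "- B \<le> f (fst p) (real (snd p) / real N)"
      using B(2)[of "fst p" "snd p"] p by (auto simp: I_def)
    ultimately show "- F p (\<lambda>q. y q t) t - B \<le> 0" by simp
  qed
  have clip_inactive: "clip t (y p t) = y p t" if "p \<in> I" "t \<in> {0..T}" for p t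
    using upper[OF that] lower[OF that] by (simp add: clip_def)
  \<comment> \<open>Undoing the time reversal: reflection maps the interval onto itself, as the
    chain rule on images requires, and its derivative -1 restores the sign of the backward
    system.\<close>
  define u where "u = (\<lambda>i n t. y (i, n) (T - t))"
  have "ode_solution N eta f psi T u"
    unfolding ode_solution_iff
  proof (intro ballI allI impI conjI)
    fix i n :: nat assume i: "i \<in> {0, 1}" and n: "n \<le> N"
    then have p: "(i, n) \<in> I" by (simp add: I_def)
    show "u i n T = psi i (real n / real N)" using y0[OF p] by (simp add: u_def)
    fix t assume t: "t \<in> {0..T}"
    then have Tt: "T - t \<in> {0..T}" by auto
    have refl_image: "(\<lambda>t. T - t) ` {0..T} = {0..T}" by simp
    have "F (i, n) (\<lambda>q. y q (T - t)) (T - t) = ode_rhs N eta f u i n t"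
      unfolding F_def h_def fst_conv snd_conv
      by (rule ode_rhs_cong[OF _ i n])
        (use clip_inactive[OF _ Tt] in \<open>auto simp: u_def I_def\<close>)
    then have "(y (i, n) has_real_derivative ode_rhs N eta f u i n t)
        (at (T - t) within ((\<lambda>t. T - t) ` {0..T}))"
      using y'[OF p Tt] unfolding refl_image by simp
    moreover have "((\<lambda>t. T - t) has_real_derivative - 1) (at t within {0..T})"
      by (auto intro!: derivative_eq_intros)
    ultimately have "(y (i, n) \<circ> (\<lambda>t. T - t) has_real_derivative ode_rhs N eta f u i n t * - 1)
        (at t within {0..T})"
      by (rule DERIV_image_chain)
    then show "(u i n has_real_derivative - ode_rhs N eta f u i n t) (at t within {0..T})"
      by (simp add: u_def comp_def)
  qed
  then show ?thesis by blast
qed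

section \<open>The product rule for absolutely continuous functions\<close>

text \<open>
  The defect of the product formula on \<open>{c..d}\<close> is the integral of
  \<open>f r * (G d - G r) + (F c - F r) * g r\<close>, which on short intervals is at most
  \<open>\<epsilon>\<close> times the integral of \<open>\<bar>f\<bar> + \<bar>g\<bar>\<close>. No differentiability is needed.
\<close>

lemma has_integral_product_rule:
  fixes f g F G :: "real \<Rightarrow> real"
  assumes ab: "a \<le> b"
    and f: "f absolutely_integrable_on {a..b}" and g: "g absolutely_integrable_on {a..b}"
    and F: "\<And>t. t \<in> {a..b} \<Longrightarrow> (f has_integral F t - F a) {a..t}"
    and G: "\<And>t. t \<in> {a..b} \<Longrightarrow> (g has_integral G t - G a) {a..t}"
  shows "((\<lambda>t. f t * G t + F t * g t) has_integral F b * G b - F a * G a) {a..b}"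
proof -
  have int: "f integrable_on {a..b}" "g integrable_on {a..b}"
    using f g by (simp_all add: absolutely_integrable_on_def)
  have F_eq: "F t = F a + integral {a..t} f" if "t \<in> {a..b}" for t
    using integral_unique[OF F[OF that]] by simp
  have G_eq: "G t = G a + integral {a..t} g" if "t \<in> {a..b}" for t
    using integral_unique[OF G[OF that]] by simp
  have "continuous_on {a..b} (\<lambda>t. F a + integral {a..t} f)"
    by (intro continuous_intros indefinite_integral_continuous_1 int)
  then have F_cont: "continuous_on {a..b} F"
    by (rule continuous_on_eq) (simp add: F_eq[symmetric])
  have "continuous_on {a..b} (\<lambda>t. G a + integral {a..t} g)"
    by (intro continuous_intros indefinite_integral_continuous_1 int)
  then have G_cont: "continuous_on {a..b} G"
    by (rule continuous_on_eq) (simp add: G_eq[symmetric])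
  \<comment> \<open>A continuous factor on a compact interval is bounded and measurable, so it
    preserves absolute integrability.\<close>
  have bounded_product: "(\<lambda>t. H t * h t) absolutely_integrable_on {a..b}"
    if "continuous_on {a..b} H" "h absolutely_integrable_on {a..b}" for H h :: "real \<Rightarrow> real"
    by (rule absolutely_integrable_bounded_measurable_product_real)
      (auto intro!: continuous_imp_measurable_on_sets_lebesgue compact_imp_bounded
        compact_continuous_image that)
  define h where "h = (\<lambda>t. f t * G t + F t * g t)"
  have h_int: "h integrable_on {a..b}"
    using set_integral_add(1)[OF bounded_product[OF G_cont f] bounded_product[OF F_cont g]]
    by (simp add: h_def mult.commute absolutely_integrable_on_def)
  have w_int: "(\<lambda>t. \<bar>f t\<bar> + \<bar>g t\<bar>) integrable_on {a..b}"
    using f g by (intro integrable_add) (auto simp: absolutely_integrable_on_def)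
  define m where "m = (\<lambda>t. integral {a..t} (\<lambda>t. \<bar>f t\<bar> + \<bar>g t\<bar>))"
  \<comment> \<open>The defect of the formula on \<open>{a..t}\<close>; it vanishes at
    \<open>a\<close>, and the aim is \<open>\<phi> b = 0\<close>.\<close>
  define \<phi> where "\<phi> = (\<lambda>t. F t * G t - F a * G a - integral {a..t} h)"
  have step: "\<bar>\<phi> d - \<phi> c\<bar> \<le> \<epsilon> * (m d - m c)"
    if cd: "c \<in> {a..b}" "d \<in> {a..b}" "c \<le> d"
      and close: "\<And>r. r \<in> {c..d} \<Longrightarrow> \<bar>G d - G r\<bar> \<le> \<epsilon>" "\<And>r. r \<in> {c..d} \<Longrightarrow> \<bar>F c - F r\<bar> \<le> \<epsilon>"
    for c d \<epsilon>
  proof -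
    have split: "integral {a..d} k - integral {a..c} k = integral {c..d} k"
      if "k integrable_on {a..b}" for k :: "real \<Rightarrow> real"
    proof -
      have "k integrable_on {a..d}"
        by (rule integrable_subinterval_real[OF that]) (use cd in auto)
      then show ?thesis
        using Henstock_Kurzweil_Integration.integral_combine[of a c d k] cd by simp
    qed
    have sub: "k integrable_on {c..d}" if "k integrable_on {a..b}" for k :: "real \<Rightarrow> real"
      by (rule integrable_subinterval_real[OF that]) (use cd in auto)
    define e where "e = (\<lambda>r. f r * G d + F c * g r - h r)"
    have e_int: "e integrable_on {c..d}"
      unfolding e_def
      by (intro integrable_diff integrable_add integrable_on_mult_left integrable_on_mult_right
          sub int h_int)
    have "integral {c..d} e = integral {c..d} f * G d + F c * integral {c..d} g - integral {c..d} h"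
      unfolding e_def
      by (simp add: integral_diff integral_add integrable_add integrable_on_mult_left
          integrable_on_mult_right sub int h_int)
    also have "integral {c..d} f = F d - F c"
      using split[OF int(1)] F_eq[OF cd(1)] F_eq[OF cd(2)] by simp
    also have "integral {c..d} g = G d - G c"
      using split[OF int(2)] G_eq[OF cd(1)] G_eq[OF cd(2)] by simp
    also have "integral {c..d} h = integral {a..d} h - integral {a..c} h"
      using split[OF h_int] by simp
    finally have "\<phi> d - \<phi> c = integral {c..d} e"
      by (simp add: \<phi>_def algebra_simps)
    moreover have "norm (integral {c..d} e) \<le> integral {c..d} (\<lambda>r. \<epsilon> * (\<bar>f r\<bar> + \<bar>g r\<bar>))"
    proof (rule integral_norm_bound_integral[OF e_int])
      show "(\<lambda>r. \<epsilon> * (\<bar>f r\<bar> + \<bar>g r\<bar>)) integrable_on {c..d}"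
        by (intro integrable_on_mult_right sub w_int)
      fix r assume r: "r \<in> {c..d}"
      have "\<bar>e r\<bar> = \<bar>(G d - G r) * f r + (F c - F r) * g r\<bar>"
        by (simp add: e_def h_def algebra_simps)
      also have "\<dots> \<le> \<bar>G d - G r\<bar> * \<bar>f r\<bar> + \<bar>F c - F r\<bar> * \<bar>g r\<bar>"
        by (simp add: abs_mult[symmetric] abs_triangle_ineq)
      also have "\<dots> \<le> \<epsilon> * \<bar>f r\<bar> + \<epsilon> * \<bar>g r\<bar>"
        using close[OF r] by (intro add_mono mult_right_mono) auto
      finally show "norm (e r) \<le> \<epsilon> * (\<bar>f r\<bar> + \<bar>g r\<bar>)" by (simp add: algebra_simps)
    qed
    moreover have "integral {c..d} (\<lambda>r. \<epsilon> * (\<bar>f r\<bar> + \<bar>g r\<bar>)) = \<epsilon> * (m d - m c)"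
      using split[OF w_int] by (simp add: m_def)
    ultimately show ?thesis by (simp only: real_norm_def)
  qed
  have bound: "\<bar>\<phi> b\<bar> \<le> \<epsilon> * m b" if \<epsilon>: "\<epsilon> > 0" for \<epsilon>
  proof -
    obtain \<delta>1 where \<delta>1: "\<delta>1 > 0"
      "\<forall>x\<in>{a..b}. \<forall>y\<in>{a..b}. dist y x < \<delta>1 \<longrightarrow> dist (F y) (F x) < \<epsilon>"
      using compact_uniformly_continuous[OF F_cont] \<epsilon> unfolding uniformly_continuous_on_def by blast
    obtain \<delta>2 where \<delta>2: "\<delta>2 > 0"
      "\<forall>x\<in>{a..b}. \<forall>y\<in>{a..b}. dist y x < \<delta>2 \<longrightarrow> dist (G y) (G x) < \<epsilon>"
      using compact_uniformly_continuous[OF G_cont] \<epsilon> unfolding uniformly_continuous_on_def by blast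
    \<comment> \<open>Halving makes distances up to and including \<open>\<delta>\<close> strictly
      smaller than both moduli of continuity.\<close>
    define \<delta> where "\<delta> = min \<delta>1 \<delta>2 / 2"
    have \<delta>: "\<delta> > 0" "\<delta> < \<delta>1" "\<delta> < \<delta>2" using \<delta>1(1) \<delta>2(1) by (auto simp: \<delta>_def)
    \<comment> \<open>Instead of fixing a partition, the induction walks back from \<open>t\<close>
      in steps of length \<open>\<delta>\<close>, stopping at \<open>a\<close>. The bounds of the
      steps add up because the increments of \<open>m\<close> telescope.\<close>
    have iterate: "\<bar>\<phi> t\<bar> \<le> \<epsilon> * m t" if "t \<in> {a..b}" "t \<le> a + real n * \<delta>" for n t
      using that
    proof (induction n arbitrary: t)
      case 0
      then have "t = a" by simp
      then show ?case by (simp add: \<phi>_def m_def)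
    next
      case (Suc n)
      define c where "c = max a (t - \<delta>)"
      have c: "c \<in> {a..b}" "c \<le> t" "t - c \<le> \<delta>" "c \<le> a + real n * \<delta>"
        using Suc.prems \<delta>(1) by (auto simp: c_def algebra_simps)
      have "\<bar>\<phi> t - \<phi> c\<bar> \<le> \<epsilon> * (m t - m c)"
      proof (rule step[OF c(1) Suc.prems(1) c(2)])
        fix r assume r: "r \<in> {c..t}"
        then have "r \<in> {a..b}" "dist t r < \<delta>2" "dist c r < \<delta>1"
          using c \<delta> Suc.prems(1) by (auto simp: dist_real_def)
        then show "\<bar>G t - G r\<bar> \<le> \<epsilon>" "\<bar>F c - F r\<bar> \<le> \<epsilon>"
          using \<delta>1(2) \<delta>2(2) c(1) Suc.prems(1) by (auto simp: dist_real_def intro: less_imp_le)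
      qed
      moreover have "\<bar>\<phi> c\<bar> \<le> \<epsilon> * m c" by (rule Suc.IH[OF c(1) c(4)])
      ultimately show ?case by (simp add: algebra_simps)
    qed
    obtain n where "(b - a) / \<delta> \<le> real n" using real_arch_simple by blast
    then have "b \<le> a + real n * \<delta>" using \<delta>(1) by (simp add: pos_divide_le_eq algebra_simps)
    then show ?thesis using iterate[of b n] ab by simp
  qed
  have "m b \<ge> 0" unfolding m_def by (rule integral_nonneg[OF w_int]) auto
  have "\<bar>\<phi> b\<bar> \<le> 0 + e" if "e > 0" for e
  proof -
    \<comment> \<open>The summand 1 avoids a division by zero when \<open>f\<close> and
      \<open>g\<close> vanish almost everywhere.\<close>
    have "\<bar>\<phi> b\<bar> \<le> e / (m b + 1) * m b" using bound[of "e / (m b + 1)"] that \<open>m b \<ge> 0\<close> by simp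
    also have "\<dots> \<le> e" using that \<open>m b \<ge> 0\<close> by (simp add: field_simps)
    finally show ?thesis by simp
  qed
  then have "\<bar>\<phi> b\<bar> \<le> 0" by (rule field_le_epsilon)
  then have "integral {a..b} h = F b * G b - F a * G a" by (simp add: \<phi>_def)
  then show ?thesis using integrable_integral[OF h_int] by (simp add: h_def)
qed

section \<open>Laws of the state process\<close>

lemma continuous_family_bounded:
  fixes g :: "'a \<Rightarrow> real \<Rightarrow> real"
  assumes "finite A" "\<And>k. k \<in> A \<Longrightarrow> continuous_on {a..b} (g k)"
  obtains R where "R \<ge> 0" and "\<And>k t. k \<in> A \<Longrightarrow> t \<in> {a..b} \<Longrightarrow> \<bar>g k t\<bar> \<le> R"
proof -
  have "bounded (\<Union>k\<in>A. g k ` {a..b})"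
    using assms by (intro bounded_UN ballI compact_imp_bounded compact_continuous_image) auto
  then obtain R where R: "R > 0" "\<forall>y\<in>(\<Union>k\<in>A. g k ` {a..b}). norm y \<le> R"
    unfolding bounded_pos by blast
  show ?thesis by (rule that[of R]) (use R in auto)
qed

section \<open>Flips of single players on the state space\<close>

lemma finite_states [simp]: "finite (states N)"
  unfolding states_def by (auto intro: finite_PiE)

lemma states_values: "s \<in> states N \<Longrightarrow> k \<le> N \<Longrightarrow> s k = 0 \<or> s k = 1"
  by (auto simp: states_def PiE_iff)

lemma flip_in_states: "s \<in> states N \<Longrightarrow> k \<le> N \<Longrightarrow> flip k s \<in> states N"
  by (auto simp: states_def flip_def PiE_iff extensional_def)

lemma flip_flip: "s \<in> states N \<Longrightarrow> k \<le> N \<Longrightarrow> flip k (flip k s) = s"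
  using states_values[of s N k] by (auto simp: flip_def)

lemma sum_flip:
  assumes "k \<le> N"
  shows "(\<Sum>s\<in>states N. h (flip k s)) = (\<Sum>s\<in>states N. h s)"
  by (rule sum.reindex_bij_witness[of _ "flip k" "flip k"])
    (use assms in \<open>auto simp: flip_in_states flip_flip\<close>)

text \<open>Inflow into \<open>s\<close> by a flip of player \<open>j\<close> is outflow from
  \<open>flip j s\<close>; reindexing by this involution moves the difference from the flow to the
  test function. This is the duality of the master equation and the generator. For constant
  \<open>w\<close> it expresses conservation of mass.\<close>

lemma sum_net_flow:
  fixes w :: "state \<Rightarrow> real"
  shows "(\<Sum>s\<in>states N. (\<Sum>j\<le>N. q j (flip j s) - q j s) * w s)
    = (\<Sum>s\<in>states N. \<Sum>j\<le>N. q j s * (w (flip j s) - w s))"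
proof -
  have swap: "(\<Sum>s\<in>states N. q j (flip j s) * w s) = (\<Sum>s\<in>states N. q j s * w (flip j s))"
    if "j \<le> N" for j
  proof -
    have "(\<Sum>s\<in>states N. q j (flip j s) * w s)
        = (\<Sum>s\<in>states N. q j (flip j s) * w (flip j (flip j s)))"
      by (rule sum.cong) (use that in \<open>auto simp: flip_flip\<close>)
    also have "\<dots> = (\<Sum>s\<in>states N. q j s * w (flip j s))"
      by (rule sum_flip[OF that, of "\<lambda>s. q j s * w (flip j s)"])
    finally show ?thesis .
  qed
  have "(\<Sum>s\<in>states N. (\<Sum>j\<le>N. q j (flip j s) - q j s) * w s)
      = (\<Sum>j\<le>N. (\<Sum>s\<in>states N. q j (flip j s) * w s) - (\<Sum>s\<in>states N. q j s * w s))"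
    unfolding sum_distrib_right left_diff_distrib
    by (subst sum.swap) (simp add: sum_subtractf)
  also have "\<dots> = (\<Sum>j\<le>N. \<Sum>s\<in>states N. q j s * (w (flip j s) - w s))"
    by (rule sum.cong) (simp_all add: swap sum_subtractf right_diff_distrib)
  also have "\<dots> = (\<Sum>s\<in>states N. \<Sum>j\<le>N. q j s * (w (flip j s) - w s))"
    by (rule sum.swap)
  finally show ?thesis .
qed

text \<open>
  The field is evaluated at the positive part of \<open>p\<close>, so that \<open>p s\<close> cannot decrease while
  negative; hence \<open>p\<close> is nonnegative and the cut-off is inactive.
\<close>

lemma state_law_exists:
  fixes \<alpha> :: profile
  assumes t0: "t0 \<le> T" and eta: "eta \<ge> 0"
    and cont: "\<And>j s. j \<le> N \<Longrightarrow> s \<in> states N \<Longrightarrow> continuous_on {t0..T} (\<alpha> j s)"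
    and nonneg: "\<And>j s t. j \<le> N \<Longrightarrow> s \<in> states N \<Longrightarrow> t \<in> {t0..T} \<Longrightarrow> 0 \<le> \<alpha> j s t"
  obtains p where "state_law N eta \<alpha> t0 T s0 p"
proof -
  define rate where "rate = (\<lambda>j s t. \<alpha> j s t + eta)"
  have rate_cont: "continuous_on {t0..T} (rate j s)" if "j \<le> N" "s \<in> states N" for j s
    unfolding rate_def by (intro continuous_intros cont that)
  have rate_nonneg: "0 \<le> rate j s t" if "j \<le> N" "s \<in> states N" "t \<in> {t0..T}" for j s t
    unfolding rate_def using nonneg[OF that] eta by simp
  obtain R where R: "R \<ge> 0"
    "\<And>k t. k \<in> {..N} \<times> states N \<Longrightarrow> t \<in> {t0..T} \<Longrightarrow> \<bar>rate (fst k) (snd k) t\<bar> \<le> R"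
    by (rule continuous_family_bounded[of "{..N} \<times> states N" t0 T "\<lambda>k. rate (fst k) (snd k)"])
      (auto intro: rate_cont)
  have R': "\<bar>rate j s t\<bar> \<le> R" if "j \<le> N" "s \<in> states N" "t \<in> {t0..T}" for j s t
    using R(2)[of "(j, s)" t] that by simp
  define F where "F = (\<lambda>s x t. \<Sum>j\<le>N. rate j (flip j s) t * max (x (flip j s)) 0
    - rate j s t * max (x s) 0)"
  obtain p where p0: "\<And>s. s \<in> states N \<Longrightarrow> p s t0 = of_bool (s = s0)"
    and p': "\<And>s t. s \<in> states N \<Longrightarrow> t \<in> {t0..T} \<Longrightarrow>
      (p s has_real_derivative F s (\<lambda>s. p s t) t) (at t within {t0..T})"
  proof (rule picard_lindelof_finite[of "states N" t0 T F "real (N + 1) * (2 * R)" "\<lambda>s. of_bool (s = s0)"])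
    fix s :: state and x y :: "state \<Rightarrow> real" and t
    assume s: "s \<in> states N" and t: "t \<in> {t0..T}"
    let ?S = "\<Sum>s\<in>states N. \<bar>x s - y s\<bar>"
    have each: "\<bar>rate j s t * max (x s) 0 - rate j s t * max (y s) 0\<bar> \<le> R * ?S"
      if "j \<le> N" "s \<in> states N" for j s
    proof -
      have "\<bar>rate j s t * max (x s) 0 - rate j s t * max (y s) 0\<bar>
          = \<bar>rate j s t\<bar> * \<bar>max (x s) 0 - max (y s) 0\<bar>"
        by (simp add: abs_mult[symmetric] right_diff_distrib)
      also have "\<dots> \<le> R * \<bar>x s - y s\<bar>"
        using R'[OF that t] R(1) by (intro mult_mono) auto
      also have "\<dots> \<le> R * ?S"
        using that member_le_sum[of s "states N" "\<lambda>s. \<bar>x s - y s\<bar>"] R(1)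
        by (intro mult_left_mono) auto
      finally show ?thesis .
    qed
    have diff_diff_eq4: "a - b - (c - d) = a - c - (b - d)" for a b c d :: real by simp
    have eq: "F s x t - F s y t = (\<Sum>j\<le>N.
        (rate j (flip j s) t * max (x (flip j s)) 0 - rate j (flip j s) t * max (y (flip j s)) 0)
        - (rate j s t * max (x s) 0 - rate j s t * max (y s) 0))"
      unfolding F_def sum_subtractf[symmetric] by (rule sum.cong[OF refl diff_diff_eq4])
    \<comment> \<open>Each of the \<open>N + 1\<close> players contributes one inflow and one
      outflow term, and each of these is Lipschitz with constant \<open>R\<close>.\<close>
    have "\<bar>F s x t - F s y t\<bar> \<le> (\<Sum>j\<le>N. 2 * R * ?S)"
      unfolding eq
    proof (rule order_trans[OF sum_abs sum_mono])
      fix j assume "j \<in> {..N}"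
      then have j: "j \<le> N" by simp
      show "\<bar>(rate j (flip j s) t * max (x (flip j s)) 0 - rate j (flip j s) t * max (y (flip j s)) 0)
        - (rate j s t * max (x s) 0 - rate j s t * max (y s) 0)\<bar> \<le> 2 * R * ?S"
        using order_trans[OF abs_triangle_ineq4 add_mono[OF each[OF j flip_in_states[OF s j]] each[OF j s]]]
        by (simp only: mult_2 distrib_right)
    qed
    also have "\<dots> = real (N + 1) * (2 * R) * ?S" by simp
    finally show "\<bar>F s x t - F s y t\<bar> \<le> real (N + 1) * (2 * R) * ?S" .
  next
    fix s :: state and x :: "state \<Rightarrow> real \<Rightarrow> real"
    assume s: "s \<in> states N" and x: "\<And>s. s \<in> states N \<Longrightarrow> continuous_on {t0..T} (x s)"
    show "continuous_on {t0..T} (\<lambda>t. F s (\<lambda>s. x s t) t)"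
      unfolding F_def by (intro continuous_intros rate_cont x) (use s in \<open>auto intro: flip_in_states\<close>)
  qed (use t0 that in auto)
  have p_nonneg: "0 \<le> p s t" if s: "s \<in> states N" and t: "t \<in> {t0..T}" for s t
  proof -
    have "- p s t \<le> 0"
    proof (rule barrier_nonpos[OF _ _ _ t])
      show "((\<lambda>t. - p s t) has_real_derivative - F s (\<lambda>s. p s t) t) (at t within {t0..T})"
        if "t \<in> {t0..T}" for t by (intro DERIV_minus p'[OF s that])
      show "- p s t0 \<le> 0" by (simp add: p0[OF s])
      fix t assume "t \<in> {t0..T}" "0 < - p s t"
      then show "- F s (\<lambda>s. p s t) t \<le> 0"
        unfolding F_def by (auto intro!: sum_nonneg mult_nonneg_nonneg rate_nonneg flip_in_states s)
    qed
    then show ?thesis by simp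
  qed
  have "state_law N eta \<alpha> t0 T s0 p"
    unfolding state_law_def
  proof (intro ballI conjI)
    fix s t assume s: "s \<in> states N" and t: "t \<in> {t0..T}"
    show "0 \<le> p s t" by (rule p_nonneg[OF s t])
    let ?g = "\<lambda>r. \<Sum>j\<le>N. (\<alpha> j (flip j s) r + eta) * p (flip j s) r - (\<alpha> j s r + eta) * p s r"
    have "(?g has_integral p s t - p s t0) {t0..t}"
    proof (rule fundamental_theorem_of_calculus)
      fix r assume "r \<in> {t0..t}"
      then have r: "r \<in> {t0..T}" using t by auto
      have "max (p s r) 0 = p s r" if "s \<in> states N" for s
        using p_nonneg[OF that r] by (simp add: max_def)
      then have "?g r = F s (\<lambda>s. p s r) r"
        unfolding F_def rate_def by (intro sum.cong refl) (simp add: s flip_in_states)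
      then have "(p s has_real_derivative ?g r) (at r within {t0..t})"
        using p'[OF s r] t by (auto intro: has_field_derivative_subset)
      then show "(p s has_vector_derivative ?g r) (at r within {t0..t})"
        by (simp add: has_real_derivative_iff_has_vector_derivative)
    qed (use t in auto)
    then show "(?g has_integral p s t - of_bool (s = s0)) {t0..t}" by (simp add: p0[OF s])
  qed
  then show ?thesis by (rule that)
qed

section \<open>Verification\<close>

text \<open>For \<open>d < 0\<close> complete the square; the minimizer \<open>- d\<close> is
  admissible. For \<open>d \<ge> 0\<close> it violates the sign constraint unless
  \<open>d = 0\<close>, and the constrained minimum is at zero.\<close>

lemma hamiltonian_le:
  fixes a d eta :: real
  assumes "a \<ge> 0"
  shows "eta * d - (max (- d) 0)\<^sup>2 / 2 \<le> a\<^sup>2 / 2 + (a + eta) * d"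
proof -
  have "a\<^sup>2 / 2 + (a + eta) * d = eta * d - d\<^sup>2 / 2 + (a + d)\<^sup>2 / 2"
    by (simp add: power2_eq_square field_simps)
  moreover have "(a + d)\<^sup>2 / 2 \<ge> 0" by simp
  ultimately have "eta * d - d\<^sup>2 / 2 \<le> a\<^sup>2 / 2 + (a + eta) * d" by linarith
  moreover have "0 \<le> a\<^sup>2 / 2 + a * d" if "d \<ge> 0" using that assms by simp
  ultimately show ?thesis by (cases "d \<ge> 0") (auto simp: max_def algebra_simps)
qed

lemma hamiltonian_attained:
  fixes d eta :: real
  defines "a \<equiv> max (- d) 0"
  shows "a\<^sup>2 / 2 + (a + eta) * d = eta * d - (max (- d) 0)\<^sup>2 / 2"
  unfolding a_def by (simp add: max_def power2_eq_square algebra_simps)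

lemma INF_hamiltonian:
  fixes d eta :: real
  shows "(INF a\<in>{0..}. a\<^sup>2 / 2 + (a + eta) * d) = eta * d - (max (- d) 0)\<^sup>2 / 2"
proof (rule cInf_eq_minimum)
  show "eta * d - (max (- d) 0)\<^sup>2 / 2 \<in> (\<lambda>a. a\<^sup>2 / 2 + (a + eta) * d) ` {0..}"
    by (intro image_eqI[where x = "max (- d) 0"] hamiltonian_attained[symmetric]) simp
qed (auto intro: hamiltonian_le)

text \<open>The control of player \<open>k\<close> has been minimized out, so
  \<open>\<alpha> k\<close> does not enter: the same value function serves against all deviations of
  this player.\<close>

definition hjb_rhs ::
  "nat \<Rightarrow> real \<Rightarrow> (nat \<Rightarrow> real \<Rightarrow> real) \<Rightarrow> nat \<Rightarrow> profile \<Rightarrow> (state \<Rightarrow> real \<Rightarrow> real)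
    \<Rightarrow> state \<Rightarrow> real \<Rightarrow> real" where
  "hjb_rhs N eta f k \<alpha> v s t = f (s k) (real (others0 N k s) / real N)
     + (eta * (v (flip k s) t - v s t) - (max (v s t - v (flip k s) t) 0)\<^sup>2 / 2)
     + (\<Sum>j\<in>{..N} - {k}. (\<alpha> j s t + eta) * (v (flip j s) t - v s t))"

lemma hjb_solution_iff:
  "hjb_solution N eta f psi t0 T k \<alpha> v \<longleftrightarrow>
     (\<forall>s\<in>states N. \<forall>t\<in>{t0..T}. (hjb_rhs N eta f k \<alpha> v s has_integral
        (v s t - psi (s k) (real (others0 N k s) / real N))) {t..T})"
  unfolding hjb_solution_def INF_hamiltonian hjb_rhs_def[abs_def] by simp

lemma hjb_rhs_continuous:
  assumes k: "k \<le> N" and s: "s \<in> states N"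
    and \<alpha>: "\<And>j s. j \<le> N \<Longrightarrow> j \<noteq> k \<Longrightarrow> s \<in> states N \<Longrightarrow> continuous_on S (\<alpha> j s)"
    and v: "\<And>s. s \<in> states N \<Longrightarrow> continuous_on S (v s)"
  shows "continuous_on S (hjb_rhs N eta f k \<alpha> v s)"
  unfolding hjb_rhs_def[abs_def]
  by (intro continuous_intros \<alpha> v) (use k s in \<open>auto intro: flip_in_states\<close>)

text \<open>The rates are only measurable; continuity comes from the law being an indefinite
  integral.\<close>

lemma state_law_continuous:
  assumes "state_law N eta \<alpha> t0 T s0 p" "s \<in> states N" "t0 \<le> T"
  shows "continuous_on {t0..T} (p s)"
proof -
  let ?g = "\<lambda>r. \<Sum>j\<le>N. (\<alpha> j (flip j s) r + eta) * p (flip j s) r - (\<alpha> j s r + eta) * p s r"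
  have g: "(?g has_integral p s t - of_bool (s = s0)) {t0..t}" if "t \<in> {t0..T}" for t
    using assms(1,2) that unfolding state_law_def by blast
  have "?g integrable_on {t0..T}" using g[of T] assms(3) by (auto intro: has_integral_integrable)
  then have "continuous_on {t0..T} (\<lambda>t. of_bool (s = s0) + integral {t0..t} ?g)"
    by (intro continuous_intros indefinite_integral_continuous_1)
  then show ?thesis
    by (rule continuous_on_eq) (simp add: integral_unique[OF g])
qed

text \<open>
  Finiteness of the cost puts \<open>(a s)\<^sup>2 * p s\<close>, hence also \<open>a s * p s\<close>, in \<open>L\<^sup>1\<close>, so that \<open>p s\<close>
  is absolutely continuous and the product rule applies to \<open>p s * v s\<close>.
\<close>

lemma cost_excess_has_integral:
  fixes a :: strategy and \<alpha> :: profile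
  assumes t0: "t0 \<le> T" and k: "k \<le> N" and s0: "s0 \<in> states N"
    and \<alpha>_cont: "\<And>j s. j \<le> N \<Longrightarrow> j \<noteq> k \<Longrightarrow> s \<in> states N \<Longrightarrow> continuous_on {t0..T} (\<alpha> j s)"
    and a: "markov_strategy N t0 T a"
    and v: "\<And>s t. s \<in> states N \<Longrightarrow> t \<in> {t0..T} \<Longrightarrow>
      (v s has_real_derivative - hjb_rhs N eta f k \<alpha> v s t) (at t within {t0..T})"
    and vT: "\<And>s. s \<in> states N \<Longrightarrow> v s T = psi (s k) (real (others0 N k s) / real N)"
    and law: "state_law N eta (\<alpha>(k := a)) t0 T s0 p"
    and cost: "((\<lambda>r. \<Sum>s\<in>states N. p s r * (f (s k) (real (others0 N k s) / real N) + (a s r)\<^sup>2 / 2))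
      has_integral (c - (\<Sum>s\<in>states N. p s T * psi (s k) (real (others0 N k s) / real N)))) {t0..T}"
  shows "((\<lambda>r. \<Sum>s\<in>states N. p s r * ((a s r)\<^sup>2 / 2 + (a s r + eta) * (v (flip k s) r - v s r)
      - (eta * (v (flip k s) r - v s r) - (max (v s r - v (flip k s) r) 0)\<^sup>2 / 2)))
    has_integral (c - v s0 t0)) {t0..T}"
proof -
  define rate where "rate = (\<lambda>j s r. (\<alpha>(k := a)) j s r + eta)"
  define l where "l = (\<lambda>s. f (s k) (real (others0 N k s) / real N))"
  define H where "H = hjb_rhs N eta f k \<alpha> v"
  define p' where "p' = (\<lambda>s r. \<Sum>j\<le>N. rate j (flip j s) r * p (flip j s) r - rate j s r * p s r)"
  have p_nonneg: "0 \<le> p s t" if "s \<in> states N" "t \<in> {t0..T}" for s t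
    using law that unfolding state_law_def by blast
  have p': "(p' s has_integral p s t - of_bool (s = s0)) {t0..t}"
    if "s \<in> states N" "t \<in> {t0..T}" for s t
    using law that unfolding state_law_def p'_def rate_def by blast
  have p_t0: "p s t0 = of_bool (s = s0)" if "s \<in> states N" for s
  proof -
    have "(p' s has_integral p s t0 - of_bool (s = s0)) {t0}" using p'[OF that, of t0] t0 by simp
    from has_integral_unique[OF this has_integral_refl(2)] show ?thesis by simp
  qed
  have p_cont: "continuous_on {t0..T} (p s)" if "s \<in> states N" for s
    by (rule state_law_continuous[OF law that t0])
  have v_cont: "continuous_on {t0..T} (v s)" if "s \<in> states N" for s
    using v[OF that] by (rule DERIV_continuous_on)
  have H_cont: "continuous_on {t0..T} (H s)" if "s \<in> states N" for s
    unfolding H_def by (rule hjb_rhs_continuous[OF k that \<alpha>_cont v_cont])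
  have a_nonneg: "0 \<le> a s t" if "s \<in> states N" "t \<in> {t0..T}" for s t
    using a that unfolding markov_strategy_def by blast
  have a_meas: "a s \<in> borel_measurable (lebesgue_on {t0..T})" if "s \<in> states N" for s
    using a that unfolding markov_strategy_def by blast
  have cost': "(\<lambda>r. \<Sum>s\<in>states N. p s r * (l s + (a s r)\<^sup>2 / 2)) integrable_on {t0..T}"
    using cost unfolding l_def by (rule has_integral_integrable)
  have "(\<lambda>r. \<Sum>s\<in>states N. p s r * l s) integrable_on {t0..T}"
    by (intro integrable_continuous_real continuous_intros p_cont)
  from integrable_diff[OF cost' this]
  have quadratic: "(\<lambda>r. \<Sum>s\<in>states N. p s r * (a s r)\<^sup>2 / 2) integrable_on {t0..T}"
    by (simp add: sum_subtractf[symmetric] algebra_simps)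
  have ap: "(\<lambda>r. a s r * p s r) absolutely_integrable_on {t0..T}" if s: "s \<in> states N" for s
  proof (rule measurable_bounded_by_integrable_imp_absolutely_integrable)
    show "(\<lambda>r. a s r * p s r) \<in> borel_measurable (lebesgue_on {t0..T})"
      by (intro borel_measurable_times a_meas s continuous_imp_measurable_on_sets_lebesgue p_cont) auto
    show "(\<lambda>r. (\<Sum>s\<in>states N. p s r * (a s r)\<^sup>2 / 2) + p s r) integrable_on {t0..T}"
      by (intro integrable_add quadratic integrable_continuous_real p_cont s)
    fix r assume r: "r \<in> {t0..T}"
    \<comment> \<open>Expanded, this is \<open>a \<le> a\<^sup>2 / 2 + 1\<close> weighted with the
      probability: the quadratic cost controls the jump rate.\<close>
    have "0 \<le> ((a s r - 1)\<^sup>2 + 1) / 2 * p s r"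
      using p_nonneg[OF s r] by (intro mult_nonneg_nonneg) auto
    then have "a s r * p s r \<le> p s r * (a s r)\<^sup>2 / 2 + p s r"
      by (simp add: power2_eq_square algebra_simps)
    \<comment> \<open>Integrability is known only for the sum over all states; its terms are
      nonnegative, so it dominates each of them.\<close>
    also have "p s r * (a s r)\<^sup>2 / 2 \<le> (\<Sum>s\<in>states N. p s r * (a s r)\<^sup>2 / 2)"
      by (rule member_le_sum[of s "states N" "\<lambda>s. p s r * (a s r)\<^sup>2 / 2"])
        (use s p_nonneg[OF _ r] in auto)
    finally show "norm (a s r * p s r) \<le> (\<Sum>s\<in>states N. p s r * (a s r)\<^sup>2 / 2) + p s r"
      using a_nonneg[OF s r] p_nonneg[OF s r] by simp
  qed simp
  have rate_p: "(\<lambda>r. rate j s r * p s r) absolutely_integrable_on {t0..T}"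
    if j: "j \<le> N" and s: "s \<in> states N" for j s
  proof (cases "j = k")
    case True
    have "(\<lambda>r. eta * p s r) absolutely_integrable_on {t0..T}"
      by (intro absolutely_integrable_continuous_real continuous_intros p_cont s)
    from set_integral_add(1)[OF ap[OF s] this] show ?thesis
      using True by (simp add: rate_def algebra_simps)
  next
    case False
    then have "continuous_on {t0..T} (\<lambda>r. (\<alpha> j s r + eta) * p s r)"
      by (intro continuous_intros \<alpha>_cont j s p_cont)
    then show ?thesis using False absolutely_integrable_continuous_real by (simp add: rate_def)
  qed
  have p'_abs: "p' s absolutely_integrable_on {t0..T}" if "s \<in> states N" for s
    unfolding p'_def
    by (intro absolutely_integrable_sum set_integral_diff(1) rate_p)
      (use that in \<open>auto intro: flip_in_states\<close>)
  \<comment> \<open>Summed over the states this is Dynkin's formula: the expected terminal value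
    minus \<open>v s0 t0\<close> is the integral of the generator term plus the time derivative of
    \<open>v\<close>.\<close>
  have "((\<lambda>r. p' s r * v s r + p s r * - H s r) has_integral p s T * v s T - p s t0 * v s t0) {t0..T}"
    if s: "s \<in> states N" for s
  proof (rule has_integral_product_rule[OF t0 p'_abs[OF s]])
    show "(\<lambda>r. - H s r) absolutely_integrable_on {t0..T}"
      by (intro absolutely_integrable_continuous_real continuous_intros H_cont s)
    show "(p' s has_integral p s t - p s t0) {t0..t}" if "t \<in> {t0..T}" for t
      using p'[OF s that] by (simp add: p_t0[OF s])
    show "((\<lambda>r. - H s r) has_integral v s t - v s t0) {t0..t}" if t: "t \<in> {t0..T}" for t
    proof (rule fundamental_theorem_of_calculus)
      fix r assume r: "r \<in> {t0..t}"
      have "(v s has_real_derivative - H s r) (at r within {t0..t})"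
        unfolding H_def by (rule has_field_derivative_subset[OF v[OF s]]) (use r t in auto)
      then show "(v s has_vector_derivative - H s r) (at r within {t0..t})"
        by (simp add: has_real_derivative_iff_has_vector_derivative)
    qed (use t in auto)
  qed
  then have "((\<lambda>r. \<Sum>s\<in>states N. p' s r * v s r + p s r * - H s r) has_integral
      (\<Sum>s\<in>states N. p s T * v s T - p s t0 * v s t0)) {t0..T}"
    by (intro has_integral_sum) auto
  from has_integral_add[OF cost this]
  have "((\<lambda>r. (\<Sum>s\<in>states N. p s r * (l s + (a s r)\<^sup>2 / 2))
      + (\<Sum>s\<in>states N. p' s r * v s r + p s r * - H s r)) has_integral
      (c - (\<Sum>s\<in>states N. p s T * psi (s k) (real (others0 N k s) / real N))
        + (\<Sum>s\<in>states N. p s T * v s T - p s t0 * v s t0))) {t0..T}"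
    unfolding l_def .
  moreover have "(\<Sum>s\<in>states N. p s T * v s T - p s t0 * v s t0)
      = (\<Sum>s\<in>states N. p s T * psi (s k) (real (others0 N k s) / real N)) - v s0 t0"
  proof -
    have "(\<Sum>s\<in>states N. p s t0 * v s t0) = (\<Sum>s\<in>states N. if s = s0 then v s t0 else 0)"
      by (rule sum.cong) (auto simp: p_t0)
    also have "\<dots> = v s0 t0" using s0 by simp
    finally show ?thesis by (simp add: sum_subtractf vT)
  qed
  moreover have "(\<Sum>s\<in>states N. p s r * (l s + (a s r)\<^sup>2 / 2))
      + (\<Sum>s\<in>states N. p' s r * v s r + p s r * - H s r)
      = (\<Sum>s\<in>states N. p s r * ((a s r)\<^sup>2 / 2 + (a s r + eta) * (v (flip k s) r - v s r)
      - (eta * (v (flip k s) r - v s r) - (max (v s r - v (flip k s) r) 0)\<^sup>2 / 2)))" for r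
  proof -
    \<comment> \<open>The jumps of the other players occur identically in the generator and in the
      HJB equation and cancel, as does the running cost \<open>l\<close>. What remains are the terms
      with the own control of player \<open>k\<close>.\<close>
    define inflow where "inflow = (\<lambda>s. \<Sum>j\<in>{..N} - {k}. (\<alpha> j s r + eta) * (v (flip j s) r - v s r))"
    have "(\<Sum>s\<in>states N. p' s r * v s r)
        = (\<Sum>s\<in>states N. \<Sum>j\<le>N. rate j s r * p s r * (v (flip j s) r - v s r))"
      unfolding p'_def by (rule sum_net_flow[of "\<lambda>j s. rate j s r * p s r"])
    also have "\<dots> = (\<Sum>s\<in>states N. p s r * ((a s r + eta) * (v (flip k s) r - v s r) + inflow s))"
    proof (rule sum.cong[OF refl])
      fix s
      have "(\<Sum>j\<in>{..N} - {k}. rate j s r * p s r * (v (flip j s) r - v s r))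
          = (\<Sum>j\<in>{..N} - {k}. p s r * ((\<alpha> j s r + eta) * (v (flip j s) r - v s r)))"
        by (rule sum.cong) (auto simp: rate_def)
      then show "(\<Sum>j\<le>N. rate j s r * p s r * (v (flip j s) r - v s r))
          = p s r * ((a s r + eta) * (v (flip k s) r - v s r) + inflow s)"
        using k
        by (subst sum.remove[of _ k]) (auto simp: rate_def inflow_def sum_distrib_left algebra_simps)
    qed
    finally have flow: "(\<Sum>s\<in>states N. p' s r * v s r)
      = (\<Sum>s\<in>states N. p s r * ((a s r + eta) * (v (flip k s) r - v s r) + inflow s))" .
    show ?thesis
      unfolding sum.distrib flow unfolding sum.distrib[symmetric]
      by (rule sum.cong) (simp_all add: H_def hjb_rhs_def l_def inflow_def algebra_simps)
  qed
  ultimately show ?thesis by simp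
qed

theorem optimal_cost_eq:
  fixes \<alpha> :: profile
  assumes t0: "t0 \<le> T" and k: "k \<le> N" and s0: "s0 \<in> states N" and eta: "eta \<ge> 0"
    and \<alpha>_cont: "\<And>j s. j \<le> N \<Longrightarrow> s \<in> states N \<Longrightarrow> continuous_on {t0..T} (\<alpha> j s)"
    and \<alpha>_nonneg: "\<And>j s t. j \<le> N \<Longrightarrow> s \<in> states N \<Longrightarrow> t \<in> {t0..T} \<Longrightarrow> 0 \<le> \<alpha> j s t"
    and v: "\<And>s t. s \<in> states N \<Longrightarrow> t \<in> {t0..T} \<Longrightarrow>
      (v s has_real_derivative - hjb_rhs N eta f k \<alpha> v s t) (at t within {t0..T})"
    and vT: "\<And>s. s \<in> states N \<Longrightarrow> v s T = psi (s k) (real (others0 N k s) / real N)"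
    and response: "\<And>s t. s \<in> states N \<Longrightarrow> t \<in> {t0..T} \<Longrightarrow>
      \<alpha> k s t = max (v s t - v (flip k s) t) 0"
  shows "optimal_cost N eta f psi T k \<alpha> s0 t0 = ereal (v s0 t0)"
proof -
  let ?C = "{c. \<exists>a. markov_strategy N t0 T a \<and> expected_cost N eta f psi T k (\<alpha>(k := a)) s0 t0 c}"
  have lower: "v s0 t0 \<le> c" if "c \<in> ?C" for c
  proof -
    from that obtain a where a: "markov_strategy N t0 T a"
      and "expected_cost N eta f psi T k (\<alpha>(k := a)) s0 t0 c" by blast
    then obtain p where law: "state_law N eta (\<alpha>(k := a)) t0 T s0 p"
      and cost: "((\<lambda>r. \<Sum>s\<in>states N. p s r * (f (s k) (real (others0 N k s) / real N) + (a s r)\<^sup>2 / 2))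
        has_integral (c - (\<Sum>s\<in>states N. p s T * psi (s k) (real (others0 N k s) / real N)))) {t0..T}"
      unfolding expected_cost_def fun_upd_same by blast
    have "0 \<le> c - v s0 t0"
    proof (rule has_integral_nonneg[OF cost_excess_has_integral[OF t0 k s0 \<alpha>_cont a v vT law cost]])
      fix r assume r: "r \<in> {t0..T}"
      show "0 \<le> (\<Sum>s\<in>states N. p s r * ((a s r)\<^sup>2 / 2 + (a s r + eta) * (v (flip k s) r - v s r)
        - (eta * (v (flip k s) r - v s r) - (max (v s r - v (flip k s) r) 0)\<^sup>2 / 2)))"
      proof (intro sum_nonneg mult_nonneg_nonneg)
        fix s assume s: "s \<in> states N"
        show "0 \<le> p s r" using law s r unfolding state_law_def by blast
        have "0 \<le> a s r" using a s r unfolding markov_strategy_def by blast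
        from hamiltonian_le[OF this, of eta "v (flip k s) r - v s r"]
        show "0 \<le> (a s r)\<^sup>2 / 2 + (a s r + eta) * (v (flip k s) r - v s r)
          - (eta * (v (flip k s) r - v s r) - (max (v s r - v (flip k s) r) 0)\<^sup>2 / 2)" by simp
      qed
    qed auto
    then show ?thesis by simp
  qed
  \<comment> \<open>For the candidate itself a law has to be produced: all controls are continuous,
    so \<open>state_law_exists\<close> applies and the running cost is integrable.\<close>
  have attained: "v s0 t0 \<in> ?C"
  proof -
    have markov: "markov_strategy N t0 T (\<alpha> k)"
      unfolding markov_strategy_def
      using k by (auto intro!: \<alpha>_nonneg continuous_imp_measurable_on_sets_lebesgue \<alpha>_cont)
    obtain p where law: "state_law N eta \<alpha> t0 T s0 p"
      by (rule state_law_exists[where \<alpha> = \<alpha> and N = N, OF t0 eta \<alpha>_cont \<alpha>_nonneg])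
    define c where "c = integral {t0..T}
        (\<lambda>r. \<Sum>s\<in>states N. p s r * (f (s k) (real (others0 N k s) / real N) + (\<alpha> k s r)\<^sup>2 / 2))
      + (\<Sum>s\<in>states N. p s T * psi (s k) (real (others0 N k s) / real N))"
    have "(\<lambda>r. \<Sum>s\<in>states N. p s r * (f (s k) (real (others0 N k s) / real N) + (\<alpha> k s r)\<^sup>2 / 2))
      integrable_on {t0..T}"
      by (intro integrable_continuous_real continuous_intros state_law_continuous[OF law _ t0]
          \<alpha>_cont k) auto
    then have cost: "((\<lambda>r. \<Sum>s\<in>states N. p s r * (f (s k) (real (others0 N k s) / real N)
        + (\<alpha> k s r)\<^sup>2 / 2)) has_integral
        (c - (\<Sum>s\<in>states N. p s T * psi (s k) (real (others0 N k s) / real N)))) {t0..T}"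
      by (simp add: c_def has_integral_integrable_integral)
    have law': "state_law N eta (\<alpha>(k := \<alpha> k)) t0 T s0 p" using law by simp
    \<comment> \<open>The response attains the pointwise minimum of the Hamiltonian, so the excess
      vanishes identically and the constructed cost must equal \<open>v s0 t0\<close>.\<close>
    have "((\<lambda>r. 0) has_integral (c - v s0 t0)) {t0..T}"
    proof (rule has_integral_eq[OF _
          cost_excess_has_integral[OF t0 k s0 \<alpha>_cont markov v vT law' cost]])
      fix r assume r: "r \<in> {t0..T}"
      show "(\<Sum>s\<in>states N. p s r * ((\<alpha> k s r)\<^sup>2 / 2 + (\<alpha> k s r + eta) * (v (flip k s) r - v s r)
        - (eta * (v (flip k s) r - v s r) - (max (v s r - v (flip k s) r) 0)\<^sup>2 / 2))) = 0"
      proof (intro sum.neutral ballI)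
        fix s assume s: "s \<in> states N"
        show "p s r * ((\<alpha> k s r)\<^sup>2 / 2 + (\<alpha> k s r + eta) * (v (flip k s) r - v s r)
          - (eta * (v (flip k s) r - v s r) - (max (v s r - v (flip k s) r) 0)\<^sup>2 / 2)) = 0"
          using hamiltonian_attained[where d = "v (flip k s) r - v s r" and eta = eta]
          by (simp add: response[OF s r])
      qed
    qed auto
    then have "c = v s0 t0" by simp
    with markov law cost show ?thesis unfolding expected_cost_def by force
  qed
  show ?thesis
    unfolding optimal_cost_def
    by (rule INF_eqI) (use lower attained in auto)
qed

text \<open>All hypotheses restrict to \<open>{t..T}\<close>, so the verification can be restarted
  from every intermediate time and state with the same \<open>v\<close>.\<close>

corollary best_responseI:
  fixes \<alpha> :: profile
  assumes k: "k \<le> N" and eta: "eta \<ge> 0"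
    and \<alpha>_cont: "\<And>j s. j \<le> N \<Longrightarrow> s \<in> states N \<Longrightarrow> continuous_on {t0..T} (\<alpha> j s)"
    and \<alpha>_nonneg: "\<And>j s t. j \<le> N \<Longrightarrow> s \<in> states N \<Longrightarrow> t \<in> {t0..T} \<Longrightarrow> 0 \<le> \<alpha> j s t"
    and v: "\<And>s t. s \<in> states N \<Longrightarrow> t \<in> {t0..T} \<Longrightarrow>
      (v s has_real_derivative - hjb_rhs N eta f k \<alpha> v s t) (at t within {t0..T})"
    and vT: "\<And>s. s \<in> states N \<Longrightarrow> v s T = psi (s k) (real (others0 N k s) / real N)"
    and response: "\<And>s t. s \<in> states N \<Longrightarrow> t \<in> {t0..T} \<Longrightarrow>
      \<alpha> k s t = max (v s t - v (flip k s) t) 0"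
  shows "best_response N eta f psi t0 T k \<alpha>"
  unfolding best_response_def hjb_solution_iff
proof (intro exI[of _ v] conjI ballI)
  fix s t assume s: "s \<in> states N" and t: "t \<in> {t0..T}"
  have sub: "{t..T} \<subseteq> {t0..T}" using t by auto
  have v_t: "(v s has_real_derivative - hjb_rhs N eta f k \<alpha> v s r) (at r within {t..T})"
    if "s \<in> states N" "r \<in> {t..T}" for s r
    by (rule has_field_derivative_subset[OF v sub]) (use that sub in auto)
  have "optimal_cost N eta f psi T k \<alpha> s t = ereal (v s t)"
    by (rule optimal_cost_eq[where v = v and N = N])
      (use t sub k s eta v_t in \<open>auto intro: continuous_on_subset[OF \<alpha>_cont] \<alpha>_nonneg vT response\<close>)
  then show "ereal (v s t) = optimal_cost N eta f psi T k \<alpha> s t" by simp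
  have "((\<lambda>r. - hjb_rhs N eta f k \<alpha> v s r) has_integral v s T - v s t) {t..T}"
    by (rule fundamental_theorem_of_calculus)
      (use t v_t[OF s] in \<open>auto simp: has_real_derivative_iff_has_vector_derivative\<close>)
  from has_integral_neg[OF this]
  show "(hjb_rhs N eta f k \<alpha> v s has_integral (v s t - psi (s k) (real (others0 N k s) / real N))) {t..T}"
    by (simp add: vT[OF s])
  show "\<alpha> k s t = max (v s t - v (flip k s) t) 0" by (rule response[OF s t])
qed

section \<open>Uniqueness\<close>

text \<open>The box is taken from the two solutions themselves, which are bounded on the compact
  interval; inside it the difference satisfies a linear bound and the Gronwall estimate
  applies.\<close>

lemma box_lipschitz_ode_unique:
  fixes x y :: "'a \<Rightarrow> real \<Rightarrow> real"
  assumes fin: "finite I" and h: "\<And>i M. i \<in> I \<Longrightarrow> box_lipschitz I M (h i)"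
    and x: "\<And>i t. i \<in> I \<Longrightarrow> t \<in> {a..b} \<Longrightarrow>
      (x i has_real_derivative - h i (\<lambda>j. x j t)) (at t within {a..b})"
    and y: "\<And>i t. i \<in> I \<Longrightarrow> t \<in> {a..b} \<Longrightarrow>
      (y i has_real_derivative - h i (\<lambda>j. y j t)) (at t within {a..b})"
    and terminal: "\<And>i. i \<in> I \<Longrightarrow> x i b = y i b"
    and i: "i \<in> I" and t: "t \<in> {a..b}"
  shows "x i t = y i t"
proof -
  obtain R where R: "\<And>i t. i \<in> I \<Longrightarrow> t \<in> {a..b} \<Longrightarrow> \<bar>x i t\<bar> \<le> R"
    by (rule continuous_family_bounded[OF fin, of a b x]) (auto intro: DERIV_continuous_on[OF x])
  obtain S where S: "\<And>i t. i \<in> I \<Longrightarrow> t \<in> {a..b} \<Longrightarrow> \<bar>y i t\<bar> \<le> S"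
    by (rule continuous_family_bounded[OF fin, of a b y]) (auto intro: DERIV_continuous_on[OF y])
  define M where "M = max R S"
  have x_box: "(\<lambda>j. x j t) \<in> sup_box I M" and y_box: "(\<lambda>j. y j t) \<in> sup_box I M"
    if "t \<in> {a..b}" for t
    using R[OF _ that] S[OF _ that] by (auto simp: sup_box_def M_def le_max_iff_disj)
  obtain L where "L \<ge> 0" and L: "\<And>k x y. k \<in> I \<Longrightarrow> x \<in> sup_box I M \<Longrightarrow> y \<in> sup_box I M \<Longrightarrow>
       \<bar>h k x - h k y\<bar> \<le> L * (\<Sum>j\<in>I. \<bar>x j - y j\<bar>)"
    by (rule box_lipschitz_uniform[where h = h and M = M, OF fin h]) (assumption, rule that)
  have "x i t - y i t = 0"
  proof (rule gronwall_zero_backward[where z = "\<lambda>i t. x i t - y i t", OF fin _ _ _ i t])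
    fix i t assume i: "i \<in> I" and t: "t \<in> {a..b}"
    show "((\<lambda>t. x i t - y i t) has_real_derivative - h i (\<lambda>j. x j t) - - h i (\<lambda>j. y j t))
      (at t within {a..b})"
      by (intro DERIV_diff x y i t)
    show "\<bar>- h i (\<lambda>j. x j t) - - h i (\<lambda>j. y j t)\<bar> \<le> L * (\<Sum>j\<in>I. \<bar>x j t - y j t\<bar>)"
      using L[OF i x_box[OF t] y_box[OF t]] by (simp add: abs_minus_commute)
  qed (simp add: terminal)
  then show ?thesis by simp
qed

lemma ode_solution_unique:
  assumes u: "ode_solution N eta f psi T u" and w: "ode_solution N eta f psi T w"
    and i: "i \<in> {0, 1}" and n: "n \<le> N" and t: "t \<in> {0..T}"
  shows "w i n t = u i n t"
proof -
  define h where "h = (\<lambda>p (x :: nat \<times> nat \<Rightarrow> real). ode_rhs N eta f (\<lambda>j m _. x (j, m)) (fst p) (snd p) 0)"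
  have h_eq: "h (i, n) (\<lambda>p. z (fst p) (snd p) t) = ode_rhs N eta f z i n t"
    if "i \<in> {0, 1}" "n \<le> N" for z i n t
    unfolding h_def fst_conv snd_conv by (rule ode_rhs_cong[OF _ that]) simp
  have der: "(z (fst p) (snd p) has_real_derivative - h p (\<lambda>q. z (fst q) (snd q) t)) (at t within {0..T})"
    and terminal: "z (fst p) (snd p) T = psi (fst p) (real (snd p) / real N)"
    if z: "ode_solution N eta f psi T z" and p: "p \<in> {0, 1} \<times> {..N}" and t: "t \<in> {0..T}" for z p t
  proof -
    have in_range: "fst p \<in> {0, 1}" "snd p \<le> N" using p by auto
    show "z (fst p) (snd p) T = psi (fst p) (real (snd p) / real N)"
      using z in_range unfolding ode_solution_iff by blast
    have "(z (fst p) (snd p) has_real_derivative - ode_rhs N eta f z (fst p) (snd p) t) (at t within {0..T})"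
      using z in_range t unfolding ode_solution_iff by blast
    then show "(z (fst p) (snd p) has_real_derivative - h p (\<lambda>q. z (fst q) (snd q) t)) (at t within {0..T})"
      using h_eq[OF in_range, of z t] by simp
  qed
  have "w (fst (i, n)) (snd (i, n)) t = u (fst (i, n)) (snd (i, n)) t"
  proof (rule box_lipschitz_ode_unique[where x = "\<lambda>p. w (fst p) (snd p)" and y = "\<lambda>p. u (fst p) (snd p)"
        and I = "{0, 1} \<times> {..N}" and h = h and a = 0 and b = T, OF _ _ der[OF w] der[OF u]])
    show "box_lipschitz ({0, 1} \<times> {..N}) M (h p)" if "p \<in> {0, 1} \<times> {..N}" for M p
      unfolding h_def by (rule ode_rhs_box_lipschitz) (use that in auto)
    show "w (fst p) (snd p) T = u (fst p) (snd p) T" if "p \<in> {0, 1} \<times> {..N}" for p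
      using terminal[OF w that t] terminal[OF u that t] by simp
  qed (use i n t in auto)
  then show ?thesis by simp
qed

text \<open>Inserting the response formula for all players at once eliminates the strategies and
  closes the system in the value functions.\<close>

definition coupled_rhs ::
  "nat \<Rightarrow> real \<Rightarrow> (nat \<Rightarrow> real \<Rightarrow> real) \<Rightarrow> nat \<Rightarrow> (nat \<Rightarrow> state \<Rightarrow> real \<Rightarrow> real) \<Rightarrow> state \<Rightarrow> real \<Rightarrow> real"
  where "coupled_rhs N eta f k v =
    hjb_rhs N eta f k (\<lambda>j s t. max (v j s t - v j (flip j s) t) 0) (v k)"

lemma coupled_rhs_box_lipschitz:
  assumes k: "k \<le> N" and s: "s \<in> states N"
  shows "box_lipschitz ({..N} \<times> states N) M (\<lambda>x. coupled_rhs N eta f k (\<lambda>j s _. x (j, s)) s t)"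
  unfolding coupled_rhs_def hjb_rhs_def power2_eq_square divide_inverse[of "_ * _"]
  by (intro box_lipschitz_intros) (use k s in \<open>auto intro: flip_in_states\<close>)

lemma coupled_hjb_unique:
  assumes v: "\<And>k s t. k \<le> N \<Longrightarrow> s \<in> states N \<Longrightarrow> t \<in> {0..T} \<Longrightarrow>
      (v k s has_real_derivative - coupled_rhs N eta f k v s t) (at t within {0..T})"
    and w: "\<And>k s t. k \<le> N \<Longrightarrow> s \<in> states N \<Longrightarrow> t \<in> {0..T} \<Longrightarrow>
      (w k s has_real_derivative - coupled_rhs N eta f k w s t) (at t within {0..T})"
    and terminal: "\<And>k s. k \<le> N \<Longrightarrow> s \<in> states N \<Longrightarrow> v k s T = w k s T"
    and k: "k \<le> N" and s: "s \<in> states N" and t: "t \<in> {0..T}"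
  shows "v k s t = w k s t"
proof -
  define h where "h = (\<lambda>p (x :: nat \<times> state \<Rightarrow> real).
    coupled_rhs N eta f (fst p) (\<lambda>j s _. x (j, s)) (snd p) 0)"
  have h_eq: "h p (\<lambda>q. z (fst q) (snd q) t) = coupled_rhs N eta f (fst p) z (snd p) t" for z p t
    by (simp add: h_def coupled_rhs_def hjb_rhs_def)
  have "v (fst (k, s)) (snd (k, s)) t = w (fst (k, s)) (snd (k, s)) t"
  proof (rule box_lipschitz_ode_unique[where x = "\<lambda>p. v (fst p) (snd p)" and y = "\<lambda>p. w (fst p) (snd p)"
        and I = "{..N} \<times> states N" and h = h and a = 0 and b = T])
    show "box_lipschitz ({..N} \<times> states N) M (h p)" if "p \<in> {..N} \<times> states N" for M p
      unfolding h_def by (rule coupled_rhs_box_lipschitz) (use that in auto)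
    fix p assume "p \<in> {..N} \<times> states N"
    then have p: "fst p \<le> N" "snd p \<in> states N" by auto
    show "v (fst p) (snd p) T = w (fst p) (snd p) T" by (rule terminal[OF p])
    fix t assume t: "t \<in> {0..T}"
    show "(v (fst p) (snd p) has_real_derivative - h p (\<lambda>q. v (fst q) (snd q) t)) (at t within {0..T})"
      unfolding h_eq by (rule v[OF p t])
    show "(w (fst p) (snd p) has_real_derivative - h p (\<lambda>q. w (fst q) (snd q) t)) (at t within {0..T})"
      unfolding h_eq by (rule w[OF p t])
  qed (use k s t in auto)
  then show ?thesis by simp
qed

section \<open>The symmetric profile\<close>

lemma others0_le: "k \<le> N \<Longrightarrow> others0 N k s \<le> N"
  unfolding others0_def by (rule order_trans[OF card_mono[of "{..N} - {k}"]]) auto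

text \<open>The right-hand side is the same for every player; equating it for two players converts
  the count seen by one into the count seen by the other.\<close>

lemma others0_add_own:
  assumes "k \<le> N"
  shows "others0 N k s + of_bool (s k = 0) = card {j \<in> {..N}. s j = 0}"
proof (cases "s k = 0")
  case True
  then have "{j \<in> {..N}. s j = 0} = insert k {j \<in> {..N} - {k}. s j = 0}" using assms by auto
  then show ?thesis using True by (simp add: others0_def)
next
  case False
  then have "{j \<in> {..N}. s j = 0} = {j \<in> {..N} - {k}. s j = 0}" by auto
  then show ?thesis using False by (simp add: others0_def)
qed

lemma others0_flip_self: "others0 N k (flip k s) = others0 N k s"
  unfolding others0_def flip_def by (intro arg_cong[where f = card]) auto

text \<open>In the first case \<open>j\<close> itself is counted, so the subtraction is not
  truncated.\<close>

lemma others0_flip: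
  assumes "j \<le> N" "j \<noteq> k"
  shows "s j = 0 \<Longrightarrow> others0 N k (flip j s) = others0 N k s - 1"
    and "s j = 1 \<Longrightarrow> others0 N k (flip j s) = others0 N k s + 1"
proof -
  let ?A = "{i \<in> {..N} - {k}. s i = 0}"
  assume "s j = 0"
  then have "{i \<in> {..N} - {k}. flip j s i = 0} = ?A - {j}" "j \<in> ?A"
    using assms by (auto simp: flip_def)
  then show "others0 N k (flip j s) = others0 N k s - 1"
    unfolding others0_def by (simp only: card_Diff_singleton)
next
  let ?A = "{i \<in> {..N} - {k}. s i = 0}"
  assume "s j = 1"
  then have "{i \<in> {..N} - {k}. flip j s i = 0} = insert j ?A" "j \<notin> ?A"
    using assms by (auto simp: flip_def)
  then show "others0 N k (flip j s) = others0 N k s + 1"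
    unfolding others0_def by simp
qed

lemma hjb_rhs_symmetric:
  assumes k: "k \<le> N" and s: "s \<in> states N"
  shows "hjb_rhs N eta f k (symmetric_profile N (alpha_star u)) (\<lambda>s. u (s k) (others0 N k s)) s t
    = ode_rhs N eta f u (s k) (others0 N k s) t"
proof -
  define i where "i = s k"
  define n where "n = others0 N k s"
  define A where "A = {j \<in> {..N} - {k}. s j = 0}"
  define B where "B = {j \<in> {..N} - {k}. s j = 1}"
  have AB: "{..N} - {k} = A \<union> B" "A \<inter> B = {}"
    using states_values[OF s] by (auto simp: A_def B_def)
  have fin: "finite A" "finite B" by (simp_all add: A_def B_def)
  have cardA: "card A = n" by (simp add: A_def n_def others0_def)
  have "card A + card B = N"
    using card_Un_disjoint[OF fin AB(2)] AB(1)[symmetric] k by simp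
  then have cardB: "real (card B) = real N - real n" using cardA by simp
  have i: "i = 0 \<or> i = 1" unfolding i_def by (rule states_values[OF s k])
  have flip_other: "flip j s k = i" if "j \<noteq> k" for j using that by (simp add: flip_def i_def)
  have flip_own: "flip k s k = 1 - i" by (simp add: flip_def i_def)
  let ?term = "\<lambda>j. (symmetric_profile N (alpha_star u) j s t + eta)
    * (u (flip j s k) (others0 N k (flip j s)) t - u (s k) (others0 N k s) t)"
  \<comment> \<open>A player \<open>j\<close> in state 0 does not count itself but counts
    \<open>k\<close> if \<open>i = 0\<close>, which gives
    \<open>n - 1 + (1 - i) = n - i\<close>.\<close>
  have A_term: "?term j = (alpha_star u 0 (n - i) t + eta) * (u i (n - 1) t - u i n t)" if "j \<in> A" for j
  proof -
    have j: "j \<le> N" "j \<noteq> k" "s j = 0" using that by (auto simp: A_def)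
    have "others0 N j s + 1 = n + of_bool (i = 0)"
      using others0_add_own[OF j(1), of s] others0_add_own[OF k, of s] j(3) by (simp add: n_def i_def)
    then have "others0 N j s = n - i" using i by auto
    then show ?thesis using j others0_flip(1)[where s = s, OF j]
      by (simp add: symmetric_profile_def flip_other n_def[symmetric] i_def[symmetric])
  qed
  \<comment> \<open>A player \<open>j\<close> in state 1 sees all \<open>n\<close> of the players in
    state 0 other than \<open>k\<close>, and in addition \<open>k\<close> if \<open>i = 0\<close>,
    which gives \<open>n + 1 - i\<close>.\<close>
  have B_term: "?term j = (alpha_star u 1 (n + 1 - i) t + eta) * (u i (n + 1) t - u i n t)" if "j \<in> B" for j
  proof -
    have j: "j \<le> N" "j \<noteq> k" "s j = 1" using that by (auto simp: B_def)
    have "others0 N j s = n + of_bool (i = 0)"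
      using others0_add_own[OF j(1), of s] others0_add_own[OF k, of s] j(3) by (simp add: n_def i_def)
    then have "others0 N j s = n + 1 - i" using i by auto
    then show ?thesis using j others0_flip(2)[where s = s, OF j]
      by (simp add: symmetric_profile_def flip_other n_def[symmetric] i_def[symmetric])
  qed
  have "(\<Sum>j\<in>{..N} - {k}. ?term j) = (\<Sum>j\<in>A. ?term j) + (\<Sum>j\<in>B. ?term j)"
    unfolding AB(1) by (rule sum.union_disjoint[OF fin AB(2)])
  also have "\<dots> = gamma_plus N eta u i n t * (u i (n + 1) t - u i n t)
      + gamma_minus eta u i n t * (u i (n - 1) t - u i n t)"
    by (simp add: A_term B_term cardA cardB gamma_plus_def gamma_minus_def)
  finally show ?thesis
    unfolding hjb_rhs_def ode_rhs_def flip_own others0_flip_self i_def[symmetric] n_def[symmetric]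
    by (simp add: alpha_star_def)
qed

lemma symmetric_coupled_rhs:
  assumes k: "k \<le> N" and s: "s \<in> states N"
  shows "coupled_rhs N eta f k (\<lambda>k s. u (s k) (others0 N k s)) s t
    = ode_rhs N eta f u (s k) (others0 N k s) t"
proof -
  have "(\<lambda>j s t. max (u (s j) (others0 N j s) t - u (flip j s j) (others0 N j (flip j s)) t) 0)
      = symmetric_profile N (alpha_star u)"
    by (intro ext) (simp add: symmetric_profile_def alpha_star_def others0_flip_self, simp add: flip_def)
  then show ?thesis unfolding coupled_rhs_def using hjb_rhs_symmetric[OF k s] by simp
qed

text \<open>A bootstrap in regularity: the integrated HJB problem makes each value function
  continuous, the response formula passes this on to the controls, and then the integrand is
  continuous, so the value functions are differentiable.\<close>

lemma nash_equilibrium_coupled_hjb: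
  assumes "nash_equilibrium N eta f psi T \<beta>" and T: "T > 0"
  obtains v where
    "\<And>k s t. k \<le> N \<Longrightarrow> s \<in> states N \<Longrightarrow> t \<in> {0..T} \<Longrightarrow>
      (v k s has_real_derivative - coupled_rhs N eta f k v s t) (at t within {0..T})"
    and "\<And>k s. k \<le> N \<Longrightarrow> s \<in> states N \<Longrightarrow> v k s T = psi (s k) (real (others0 N k s) / real N)"
    and "\<And>k s t. k \<le> N \<Longrightarrow> s \<in> states N \<Longrightarrow> t \<in> {0..T} \<Longrightarrow>
      \<beta> k s t = max (v k s t - v k (flip k s) t) 0"
proof -
  have "\<forall>k. \<exists>v. k \<le> N \<longrightarrow> hjb_solution N eta f psi 0 T k \<beta> v \<and>
      (\<forall>s\<in>states N. \<forall>t\<in>{0..T}. \<beta> k s t = max (v s t - v (flip k s) t) 0)"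
    using assms(1) unfolding nash_equilibrium_def best_response_def by blast
  from choice[OF this] obtain v where
    hjb: "\<And>k. k \<le> N \<Longrightarrow> hjb_solution N eta f psi 0 T k \<beta> (v k)" and
    \<beta>: "\<And>k s t. k \<le> N \<Longrightarrow> s \<in> states N \<Longrightarrow> t \<in> {0..T} \<Longrightarrow>
      \<beta> k s t = max (v k s t - v k (flip k s) t) 0" by blast
  have int: "(hjb_rhs N eta f k \<beta> (v k) s has_integral
      (v k s t - psi (s k) (real (others0 N k s) / real N))) {t..T}"
    if "k \<le> N" "s \<in> states N" "t \<in> {0..T}" for k s t
    using hjb[OF that(1)] that(2,3) unfolding hjb_solution_iff by blast
  have v_eq: "psi (s k) (real (others0 N k s) / real N) + integral {t..T} (hjb_rhs N eta f k \<beta> (v k) s)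
      = v k s t" if "k \<le> N" "s \<in> states N" "t \<in> {0..T}" for k s t
    using integral_unique[OF int[OF that]] by simp
  have v_cont: "continuous_on {0..T} (v k s)" if ks: "k \<le> N" "s \<in> states N" for k s
  proof (rule continuous_on_eq)
    show "continuous_on {0..T} (\<lambda>t. psi (s k) (real (others0 N k s) / real N)
        + integral {t..T} (hjb_rhs N eta f k \<beta> (v k) s))"
      by (intro continuous_intros indefinite_integral_continuous_1'
          has_integral_integrable[OF int[OF ks]]) (use T in auto)
  qed (rule v_eq[OF ks])
  have \<beta>_cont: "continuous_on {0..T} (\<beta> k s)" if ks: "k \<le> N" "s \<in> states N" for k s
  proof (rule continuous_on_eq)
    show "continuous_on {0..T} (\<lambda>t. max (v k s t - v k (flip k s) t) 0)"
      by (intro continuous_intros v_cont ks flip_in_states)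
  qed (simp add: \<beta>[OF ks])
  have rhs_eq: "hjb_rhs N eta f k \<beta> (v k) s t = coupled_rhs N eta f k v s t"
    if "k \<le> N" "s \<in> states N" "t \<in> {0..T}" for k s t
    unfolding coupled_rhs_def hjb_rhs_def using that by (simp add: \<beta>)
  show ?thesis
  proof (rule that)
    fix k s assume ks: "k \<le> N" "s \<in> states N"
    show "v k s T = psi (s k) (real (others0 N k s) / real N)" using v_eq[OF ks, of T] T by simp
    fix t assume t: "t \<in> {0..T}"
    have "((\<lambda>t. psi (s k) (real (others0 N k s) / real N)
        + integral {t..T} (hjb_rhs N eta f k \<beta> (v k) s))
        has_real_derivative 0 + - hjb_rhs N eta f k \<beta> (v k) s t) (at t within {0..T})"
      by (intro DERIV_add DERIV_const integral_has_real_derivative' t hjb_rhs_continuous ks \<beta>_cont v_cont)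
    then have "((\<lambda>t. psi (s k) (real (others0 N k s) / real N)
        + integral {t..T} (hjb_rhs N eta f k \<beta> (v k) s))
        has_real_derivative - coupled_rhs N eta f k v s t) (at t within {0..T})"
      by (simp add: rhs_eq[OF ks t])
    then show "(v k s has_real_derivative - coupled_rhs N eta f k v s t) (at t within {0..T})"
      by (rule has_field_derivative_transform_within[OF _ zero_less_one t]) (rule v_eq[OF ks])
  qed (rule \<beta>)
qed

theorem mainTheorem5:
  fixes T eta :: real and N :: nat and f psi :: "nat \<Rightarrow> real \<Rightarrow> real"
  assumes "T > 0" and "eta \<ge> 0" and "N \<ge> 1"
    and "admissible_data f" and "admissible_data psi"
  shows "\<exists>u. ode_solution N eta f psi T u \<and>
           (\<forall>w. ode_solution N eta f psi T w \<longrightarrow>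
              (\<forall>i\<in>{0, 1}. \<forall>n\<le>N. \<forall>t\<in>{0..T}. w i n t = u i n t)) \<and>
           nash_equilibrium N eta f psi T (symmetric_profile N (alpha_star u)) \<and>
           markov_perfect N eta f psi T (symmetric_profile N (alpha_star u)) \<and>
           (\<forall>\<beta>. nash_equilibrium N eta f psi T \<beta> \<longrightarrow>
              (\<forall>k\<le>N. \<forall>s\<in>states N. \<forall>t\<in>{0..T}.
                 \<beta> k s t = symmetric_profile N (alpha_star u) k s t))"
proof -
  obtain u where u: "ode_solution N eta f psi T u"
    using ode_solution_exists[OF assms] by blast
  define \<alpha> where "\<alpha> = symmetric_profile N (alpha_star u)"
  define v where "v = (\<lambda>k s. u (s k) (others0 N k s))"
  \<comment> \<open>Flipping the own state leaves the count of the others unchanged, so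
    \<open>alpha_star\<close> is the response formula for \<open>v\<close>.\<close>
  have \<alpha>: "\<alpha> k s t = max (v k s t - v k (flip k s) t) 0" for k s t
    by (simp add: \<alpha>_def v_def symmetric_profile_def alpha_star_def others0_flip_self)
      (simp add: flip_def)
  have v_der: "(v k s has_real_derivative - ode_rhs N eta f u (s k) (others0 N k s) t)
      (at t within {0..T})" if "k \<le> N" "s \<in> states N" "t \<in> {0..T}" for k s t
    using u that others0_le[of k N s] states_values[of s N k]
    unfolding ode_solution_iff v_def by blast
  have v_T: "v k s T = psi (s k) (real (others0 N k s) / real N)"
    if "k \<le> N" "s \<in> states N" for k s
    using u that others0_le[of k N s] states_values[of s N k]
    unfolding ode_solution_iff v_def by blast
  have \<alpha>_cont: "continuous_on {0..T} (\<alpha> k s)" if "k \<le> N" "s \<in> states N" for k s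
    unfolding \<alpha>
    by (intro continuous_intros DERIV_continuous_on[OF v_der] flip_in_states that)
  have \<alpha>_nonneg: "0 \<le> \<alpha> k s t" for k s t by (simp add: \<alpha>)
  \<comment> \<open>Quantifying over the starting time covers both claims: time 0 gives the Nash
    property, all times give perfection.\<close>
  have best: "best_response N eta f psi t0 T k \<alpha>" if t0: "t0 \<in> {0..T}" and k: "k \<le> N" for t0 k
  proof (rule best_responseI[where v = "v k", OF k assms(2)])
    have sub: "{t0..T} \<subseteq> {0..T}" using t0 by auto
    show "continuous_on {t0..T} (\<alpha> j s)" if "j \<le> N" "s \<in> states N" for j s
      by (rule continuous_on_subset[OF \<alpha>_cont[OF that] sub])
    show "(v k s has_real_derivative - hjb_rhs N eta f k \<alpha> (v k) s t) (at t within {t0..T})"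
      if "s \<in> states N" "t \<in> {t0..T}" for s t
      using has_field_derivative_subset[OF v_der[OF k that(1)] sub] that sub
        hjb_rhs_symmetric[OF k that(1), of eta f u t]
      by (auto simp: \<alpha>_def v_def)
  qed (use k in \<open>simp_all add: \<alpha>_nonneg v_T \<alpha>\<close>)
  have "markov_strategy N 0 T (\<alpha> k)" if "k \<le> N" for k
    unfolding markov_strategy_def
    by (auto intro!: continuous_imp_measurable_on_sets_lebesgue \<alpha>_cont that \<alpha>_nonneg)
  then have "nash_equilibrium N eta f psi T \<alpha>"
    unfolding nash_equilibrium_def using best assms(1) by auto
  moreover have "markov_perfect N eta f psi T \<alpha>"
    unfolding markov_perfect_def using best by blast
  moreover have "\<beta> k s t = \<alpha> k s t"
    if \<beta>: "nash_equilibrium N eta f psi T \<beta>" and k: "k \<le> N" and s: "s \<in> states N" and t: "t \<in> {0..T}"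
    for \<beta> k s t
  proof -
    obtain w where w: "\<And>k s t. k \<le> N \<Longrightarrow> s \<in> states N \<Longrightarrow> t \<in> {0..T} \<Longrightarrow>
        (w k s has_real_derivative - coupled_rhs N eta f k w s t) (at t within {0..T})"
      and w_T: "\<And>k s. k \<le> N \<Longrightarrow> s \<in> states N \<Longrightarrow> w k s T = psi (s k) (real (others0 N k s) / real N)"
      and \<beta>_eq: "\<And>k s t. k \<le> N \<Longrightarrow> s \<in> states N \<Longrightarrow> t \<in> {0..T} \<Longrightarrow>
        \<beta> k s t = max (w k s t - w k (flip k s) t) 0"
      using nash_equilibrium_coupled_hjb[OF \<beta> assms(1)] by blast
    \<comment> \<open>All states are needed, since the control compares the values at
      \<open>s\<close> and at \<open>flip k s\<close>.\<close>
    have "w k s t = v k s t" if "s \<in> states N" for s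
    proof (rule coupled_hjb_unique[OF w _ _ k that t])
      show "(v k s has_real_derivative - coupled_rhs N eta f k v s t) (at t within {0..T})"
        if "k \<le> N" "s \<in> states N" "t \<in> {0..T}" for k s t
        using v_der[OF that] symmetric_coupled_rhs[OF that(1,2), of eta f u t] by (simp add: v_def)
    qed (simp_all add: w_T v_T)
    then show ?thesis by (simp add: \<beta>_eq[OF k s t] \<alpha> s flip_in_states k)
  qed
  ultimately show ?thesis
    using u ode_solution_unique[OF u] unfolding \<alpha>_def by blast
qed

end
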